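(* Let $G=(V,E)$ be a simple undirected graph with $V=[m]$ and let $n\ge 1$. If the edge set $E$ is an independent set in the $(n-1)$-dimensional generic rigidity matroid $\mathcal{A}(n-1)$, then the maximum likelihood threshold of $G$ satisfies $\mathrm{mlt}(G)\le n$.
   Context: For $m$ fixed, $\mathbb{S}^m$ denotes real symmetric $m\times m$ matrices, $\mathbb{S}^m_{>0}$ the positive definite ones, $\mathbb{S}^m_{\ge 0}$ the positive semidefinite ones, and $Sym(m,n)$ the symmetric $m\times m$ matrices of rank at most $n$. For a graph $G=(V,E)$ on $V=[m]$, $\phi_G:\mathbb{S}^m\to\mathbb{R}^{V+E}$, $\phi_G(\Sigma)=(\sigma_{ii})_{i\in V}\oplus(\sigma_{ij})_{ij\in E}$. The maximum likelihood threshold $\mathrm{mlt}(G)$ is the smallest $n$ such that for almost all $\Sigma_0\in Sym(m,n)\cap\mathbb{S}^m_{\ge0}$ (equivalently, $\Sigma_0=P^TP$ for Lebesgue-almost all $P\in\mathbb{R}^{n\times m}$) there exists $\Sigma\in\mathbb{S}^m_{>0}$ with $\phi_G(\Sigma_0)=\phi_G(\Sigma)$ (i.e. the maximum likelihood estimate in the zero-mean Gaussian graphical model of $G$ exists almost surely with $n$ observations). The generic rigidity matroid $\mathcal{A}(d)$ (on $m$ points) is defined as follows: let $P=(p_{kj})$ be a $d\times m$ matrix of algebraically independent indeterminates with columns $\mathbf{p}_1,\dots,\mathbf{p}_m$, and $f_{ij}=\|\mathbf{p}_i-\mathbf{p}_j\|_2^2\in\mathbb{R}[p]$ for $1\le i<j\le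 m$; $\mathcal{A}(d)$ is the algebraic matroid on the polynomials $f_{ij}$ (a set is independent iff it is algebraically independent over $\mathbb{R}$). A set of edges $E$ is independent in $\mathcal{A}(d)$ if $\{f_{ij}:ij\in E\}$ is algebraically independent. *)

theory Defs
  imports "HOL-Analysis.Analysis" "HOL-Library.Poly_Mapping"
begin

text \<open>
  The ring \<open>\<real>[x\<^sub>v | v \<in> 'x]\<close>: finitely supported maps from monomials (finitely supported exponent
  vectors) to coefficients, with the convolution product of \<open>Poly_Mapping\<close>.
\<close>

type_synonym 'x rpoly = "('x \<Rightarrow>\<^sub>0 nat) \<Rightarrow>\<^sub>0 real"

definition rconst :: "real \<Rightarrow> 'x rpoly" where
  "rconst c = Poly_Mapping.single 0 c"

definition rvar :: "'x \<Rightarrow> 'x rpoly" where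
  "rvar v = Poly_Mapping.single (Poly_Mapping.single v 1) 1"

definition rsubst :: "('e \<Rightarrow> 'x rpoly) \<Rightarrow> 'e rpoly \<Rightarrow> 'x rpoly" where
  "rsubst g Q = (\<Sum>\<mu>\<in>Poly_Mapping.keys Q.
     rconst (Poly_Mapping.lookup Q \<mu>) *
       (\<Prod>e\<in>Poly_Mapping.keys \<mu>. g e ^ Poly_Mapping.lookup \<mu> e))"

definition alg_independent :: "'e set \<Rightarrow> ('e \<Rightarrow> 'x rpoly) \<Rightarrow> bool" where
  "alg_independent I g \<longleftrightarrow>
     (\<forall>Q :: 'e rpoly. (\<forall>\<mu>\<in>Poly_Mapping.keys Q. Poly_Mapping.keys \<mu> \<subseteq> I) \<and> rsubst g Q = 0 \<longrightarrow> Q = 0)"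

text \<open>
  The vertex set \<open>[m]\<close> is the universe of a finite linearly ordered type \<open>'m\<close> and a simple undirected
  graph is given by its set of two-element edges; the edge \<open>ij\<close> with \<open>i < j\<close> is \<open>{i, j}\<close>, so that
  \<open>i\<close> and \<open>j\<close> are its \<open>Min\<close> and \<open>Max\<close>.
\<close>

definition simple_graph :: "'m::{finite,linorder} set set \<Rightarrow> bool" where
  "simple_graph E \<longleftrightarrow> (\<forall>e\<in>E. card e = 2)"

text \<open>The indeterminate \<open>p\<^sub>k\<^sub>j\<close> is \<open>rvar (k, j)\<close>, with rows numbered from \<open>0\<close>.\<close>

definition sqdist_poly :: "nat \<Rightarrow> 'm \<Rightarrow> 'm \<Rightarrow> (nat \<times> 'm) rpoly" where
  "sqdist_poly d i j = (\<Sum>k<d. (rvar (k, i) - rvar (k, j))\<^sup>2)"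

definition rigidity_independent :: "nat \<Rightarrow> 'm::{finite,linorder} set set \<Rightarrow> bool" where
  "rigidity_independent d E \<longleftrightarrow> alg_independent E (\<lambda>e. sqdist_poly d (Min e) (Max e))"

definition pos_def :: "real^'m^'m \<Rightarrow> bool" where
  "pos_def A \<longleftrightarrow> transpose A = A \<and> (\<forall>x. x \<noteq> 0 \<longrightarrow> x \<bullet> (A *v x) > 0)"

definition graph_proj ::
    "'m set set \<Rightarrow> real^'m::{finite,linorder}^'m::{finite,linorder} \<Rightarrow> 'm + 'm set \<Rightarrow> real" where
  "graph_proj E \<Sigma> =
     restrict (case_sum (\<lambda>i. \<Sigma> $ i $ i) (\<lambda>e. \<Sigma> $ Min e $ Max e)) (UNIV <+> E)"

text \<open>
  An \<open>n \<times> m\<close> matrix \<open>P\<close> is a function on the index set \<open>{..<n} \<times> UNIV\<close>, because \<open>n\<close> varies in the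
  definition of the threshold. The matrix below is \<open>P\<^sup>T P\<close>.
\<close>

definition gram :: "nat \<Rightarrow> (nat \<times> 'm \<Rightarrow> real) \<Rightarrow> real^'m^'m" where
  "gram n P = (\<chi> i j. \<Sum>k<n. P (k, i) * P (k, j))"

definition mle_exists_as :: "'m::{finite,linorder} set set \<Rightarrow> nat \<Rightarrow> bool" where
  "mle_exists_as E n \<longleftrightarrow>
     (AE P in (\<Pi>\<^sub>M kj\<in>{..<n} \<times> (UNIV :: 'm set). lborel).
        \<exists>\<Sigma>. pos_def \<Sigma> \<and> graph_proj E (gram n P) = graph_proj E \<Sigma>)"

text \<open>The minimum exists, since \<open>n = CARD('m)\<close> satisfies the condition for every graph.\<close>

definition mlt :: "'m::{finite,linorder} set set \<Rightarrow> nat" where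
  "mlt E = (LEAST n. mle_exists_as E n)"

end

theory Submission
  imports Defs "HOL-Computational_Algebra.Polynomial"
begin

text \<open>
  Write \<open>d = n - 1\<close>. Suppose the generic rank \<open>r\<close> of the Jacobian of the squared distances
  \<open>F\<^sub>e\<close>, \<open>e \<in> E\<close>, were smaller than \<open>card E\<close>. There are then \<open>r\<close> coordinates \<open>S\<close> such that every
  other partial derivative of every polynomial \<open>g = Q(F)\<close> is a rational combination, independent of
  \<open>Q\<close>, of its partial derivatives along \<open>S\<close>; so \<open>g = 0\<close> as soon as \<open>g\<close> vanishes on an affine slice
  parallel to \<open>S\<close>. The latter is a number of linear conditions on \<open>Q\<close> that grows with the \<open>r\<close>-th
  power of the degree, which leaves a nonzero \<open>Q\<close>. Hence algebraic independence produces a placement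
  \<open>p\<close> in dimension \<open>d\<close> without equilibrium stress.

  The cone \<open>(p, 1)\<close> in dimension \<open>n\<close> is then a point where the derivative of
  \<open>P \<mapsto> \<phi>\<^sub>G(P\<^sup>T P)\<close> is onto. Surjectivity is the nonvanishing of a polynomial, so it holds for almost
  all \<open>P\<close>, and there the map is open: \<open>\<phi>\<^sub>G(P\<^sup>T P) - \<phi>\<^sub>G(\<epsilon> I) = \<phi>\<^sub>G(Q\<^sup>T Q)\<close> for some \<open>\<epsilon> > 0\<close> and \<open>Q\<close>, so
  that \<open>Q\<^sup>T Q + \<epsilon> I\<close> is the positive definite completion.
\<close>

section \<open>Polynomial functions\<close>

text \<open>Polynomials are taken as functions, so that identities are pointwise and properties
  follow by induction on how the function is built. The index type may be infinite; only coordinates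
  in \<open>X\<close> are read.\<close>

inductive_set polyfun :: "'x set \<Rightarrow> (('x \<Rightarrow> real) \<Rightarrow> real) set" for X where
  polyfun_const: "(\<lambda>_. c) \<in> polyfun X"
| polyfun_var: "k \<in> X \<Longrightarrow> (\<lambda>x. x k) \<in> polyfun X"
| polyfun_add: "f \<in> polyfun X \<Longrightarrow> g \<in> polyfun X \<Longrightarrow> (\<lambda>x. f x + g x) \<in> polyfun X"
| polyfun_mult: "f \<in> polyfun X \<Longrightarrow> g \<in> polyfun X \<Longrightarrow> (\<lambda>x. f x * g x) \<in> polyfun X"

lemma polyfun_uminus: "f \<in> polyfun X \<Longrightarrow> (\<lambda>x. - f x) \<in> polyfun X"
  using polyfun_mult[OF polyfun_const[of "-1"], of f X] by simp

lemma polyfun_diff: "f \<in> polyfun X \<Longrightarrow> g \<in> polyfun X \<Longrightarrow> (\<lambda>x. f x - g x) \<in> polyfun X"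
  using polyfun_add[OF _ polyfun_uminus, of f X g] by simp

lemma polyfun_sum:
  "(\<And>a. a \<in> A \<Longrightarrow> f a \<in> polyfun X) \<Longrightarrow> (\<lambda>x. \<Sum>a\<in>A. f a x) \<in> polyfun X"
  by (induction A rule: infinite_finite_induct) (auto intro: polyfun_const polyfun_add)

lemma polyfun_prod:
  "(\<And>a. a \<in> A \<Longrightarrow> f a \<in> polyfun X) \<Longrightarrow> (\<lambda>x. \<Prod>a\<in>A. f a x) \<in> polyfun X"
  by (induction A rule: infinite_finite_induct) (auto intro: polyfun_const polyfun_mult)

lemma polyfun_power: "f \<in> polyfun X \<Longrightarrow> (\<lambda>x. f x ^ n) \<in> polyfun X"
  by (induction n) (auto intro: polyfun_const polyfun_mult)

lemmas polyfun_intros = polyfun_const polyfun_var polyfun_add polyfun_mult polyfun_uminus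
  polyfun_diff polyfun_sum polyfun_prod polyfun_power

lemma polyfun_cong:
  assumes "f \<in> polyfun X" "\<And>k. k \<in> X \<Longrightarrow> x k = y k"
  shows "f x = f y"
  using assms by induction auto

lemma polyfun_line:
  assumes "f \<in> polyfun X"
  shows "\<exists>q. \<forall>t. f (\<lambda>i. a i + t * b i) = poly q t"
  using assms
proof induction
  case (polyfun_const c)
  then show ?case by (intro exI[of _ "[:c:]"]) auto
next
  case (polyfun_var k)
  then show ?case by (intro exI[of _ "[:a k, b k:]"]) auto
next
  case (polyfun_add f g)
  then show ?case by (metis poly_add)
next
  case (polyfun_mult f g)
  then show ?case by (metis poly_mult)
qed

text \<open>Restricted to the line through \<open>a\<close> and \<open>b\<close>, both functions are
  nonzero univariate polynomials, and so is their product. Staying on this line keeps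
  \<open>z\<close> in every coordinate slice that contains \<open>a\<close> and
  \<open>b\<close>.\<close>

lemma polyfun_common_nonzero:
  assumes "f \<in> polyfun X" "g \<in> polyfun X" "f a \<noteq> 0" "g b \<noteq> 0"
  shows "\<exists>z. f z \<noteq> 0 \<and> g z \<noteq> 0 \<and> (\<forall>i. a i = b i \<longrightarrow> z i = a i)"
proof -
  define z where "z t = (\<lambda>i. a i + t * (b i - a i))" for t
  have z: "z 0 = a" "z 1 = b" by (auto simp: z_def)
  obtain p where p: "\<And>t. f (z t) = poly p t"
    using polyfun_line[OF assms(1), of a "\<lambda>i. b i - a i"] unfolding z_def by blast
  obtain q where q: "\<And>t. g (z t) = poly q t"
    using polyfun_line[OF assms(2), of a "\<lambda>i. b i - a i"] unfolding z_def by blast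
  have "p \<noteq> 0" using p[of 0] assms(3) z by auto
  moreover have "q \<noteq> 0" using q[of 1] assms(4) z by auto
  ultimately have "p * q \<noteq> 0" by simp
  then obtain t where "poly (p * q) t \<noteq> 0" by (meson poly_all_0_iff_0)
  then have "f (z t) \<noteq> 0" "g (z t) \<noteq> 0" using p q by auto
  then show ?thesis by (intro exI[of _ "z t"]) (simp add: z_def)
qed

lemma polyfun_finite_nonzero:
  assumes "finite A" "\<And>a. a \<in> A \<Longrightarrow> f a \<in> polyfun X" "\<And>a. a \<in> A \<Longrightarrow> \<exists>x. f a x \<noteq> 0"
  shows "\<exists>x. \<forall>a\<in>A. f a x \<noteq> 0"
  using assms
proof (induction A rule: finite_induct)
  case (insert a A)
  then obtain x where x: "\<forall>a\<in>A. f a x \<noteq> 0" by auto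
  obtain y where y: "f a y \<noteq> 0" using insert.prems by auto
  have g: "(\<lambda>x. \<Prod>a\<in>A. f a x) \<in> polyfun X" using insert by (auto intro: polyfun_prod)
  have "(\<Prod>a\<in>A. f a x) \<noteq> 0" using x insert by auto
  then obtain z where "f a z \<noteq> 0" "(\<Prod>a\<in>A. f a z) \<noteq> 0"
    using polyfun_common_nonzero[of "f a" X "\<lambda>x. \<Prod>a\<in>A. f a x" y x] g y insert.prems(1) by auto
  then show ?case using insert.hyps by auto
qed auto

section \<open>Degrees in single coordinates and vanishing on grids\<close>

definition coord_degree_le :: "nat \<Rightarrow> (('x \<Rightarrow> real) \<Rightarrow> real) \<Rightarrow> bool" where
  "coord_degree_le N f \<longleftrightarrow> (\<forall>x k. \<exists>q. degree q \<le> N \<and> (\<forall>t. f (x(k := t)) = poly q t))"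

lemma coord_degree_le_mono: "coord_degree_le N f \<Longrightarrow> N \<le> M \<Longrightarrow> coord_degree_le M f"
  unfolding coord_degree_le_def by (meson order_trans)

lemma coord_degree_le_const: "coord_degree_le N (\<lambda>_. c)"
  unfolding coord_degree_le_def by (intro allI exI[of _ "[:c:]"]) auto

lemma coord_degree_le_var: "coord_degree_le 1 (\<lambda>x. x k)"
  unfolding coord_degree_le_def
proof (intro allI)
  fix x :: "'a \<Rightarrow> real" and j
  show "\<exists>q. degree q \<le> 1 \<and> (\<forall>t. (x(j := t)) k = poly q t)"
    by (intro exI[of _ "if j = k then [:0, 1:] else [:x k:]"]) auto
qed

lemma coord_degree_le_add:
  assumes "coord_degree_le N f" "coord_degree_le N g"
  shows "coord_degree_le N (\<lambda>x. f x + g x)"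
  unfolding coord_degree_le_def
proof (intro allI)
  fix x k
  obtain p q where "degree p \<le> N" "\<forall>t. f (x(k := t)) = poly p t"
    "degree q \<le> N" "\<forall>t. g (x(k := t)) = poly q t"
    using assms unfolding coord_degree_le_def by meson
  then show "\<exists>q. degree q \<le> N \<and> (\<forall>t. f (x(k := t)) + g (x(k := t)) = poly q t)"
    by (intro exI[of _ "p + q"]) (auto intro: degree_add_le)
qed

lemma coord_degree_le_mult:
  assumes "coord_degree_le N f" "coord_degree_le M g"
  shows "coord_degree_le (N + M) (\<lambda>x. f x * g x)"
  unfolding coord_degree_le_def
proof (intro allI)
  fix x k
  obtain p q where "degree p \<le> N" "\<forall>t. f (x(k := t)) = poly p t"
    "degree q \<le> M" "\<forall>t. g (x(k := t)) = poly q t"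
    using assms unfolding coord_degree_le_def by meson
  then show "\<exists>q. degree q \<le> N + M \<and> (\<forall>t. f (x(k := t)) * g (x(k := t)) = poly q t)"
    by (intro exI[of _ "p * q"]) (auto intro: order_trans[OF degree_mult_le])
qed

lemma coord_degree_le_sum:
  "(\<And>a. a \<in> A \<Longrightarrow> coord_degree_le N (f a)) \<Longrightarrow> coord_degree_le N (\<lambda>x. \<Sum>a\<in>A. f a x)"
  by (induction A rule: infinite_finite_induct)
    (auto intro: coord_degree_le_const coord_degree_le_add)

lemma coord_degree_le_power:
  assumes "coord_degree_le N f"
  shows "coord_degree_le (n * N) (\<lambda>x. f x ^ n)"
  by (induction n) (auto intro: coord_degree_le_const coord_degree_le_mult assms)

lemma coord_degree_le_prod:
  "(\<And>a. a \<in> A \<Longrightarrow> coord_degree_le N (f a)) \<Longrightarrow> coord_degree_le (card A * N) (\<lambda>x. \<Prod>a\<in>A. f a x)"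
  by (induction A rule: infinite_finite_induct)
    (auto intro: coord_degree_le_const coord_degree_le_mult)

lemma polyfun_coord_degree:
  assumes "f \<in> polyfun X"
  shows "\<exists>N. coord_degree_le N f"
  using assms
proof induction
  case (polyfun_add f g)
  then obtain N M where "coord_degree_le N f" "coord_degree_le M g" by auto
  then have "coord_degree_le (max N M) f" "coord_degree_le (max N M) g"
    by (auto intro: coord_degree_le_mono)
  then show ?case by (blast intro: coord_degree_le_add)
qed (blast intro: coord_degree_le_const coord_degree_le_var coord_degree_le_mult)+

lemma polyfun_coord:
  assumes "f \<in> polyfun X"
  obtains q where "\<And>t. f (x(k := t)) = poly q t"
  using polyfun_coord_degree[OF assms] unfolding coord_degree_le_def by meson

text \<open>Induction on \<open>S\<close>: in each of its coordinates \<open>f\<close> is a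
  univariate polynomial of degree at most \<open>N\<close> with the \<open>N + 1\<close> roots
  \<open>0, ..., N\<close>.\<close>

lemma zero_on_grid_imp_zero_on_slice:
  fixes f :: "('x \<Rightarrow> real) \<Rightarrow> real"
  assumes "finite S" "coord_degree_le N f"
    and "\<And>y. \<lbrakk>\<And>k. k \<in> S \<Longrightarrow> y k \<in> real ` {..N}; \<And>k. k \<notin> S \<Longrightarrow> y k = p k\<rbrakk> \<Longrightarrow> f y = 0"
    and "\<And>k. k \<notin> S \<Longrightarrow> y k = p k"
  shows "f y = 0"
  using assms(1,3,4)
proof (induction S arbitrary: y p rule: finite_induct)
  case empty
  then show ?case by auto
next
  case (insert k S)
  obtain q where q: "degree q \<le> N" "\<And>t. f (y(k := t)) = poly q t"
    using assms(2) unfolding coord_degree_le_def by meson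
  have "poly q s = 0" if s: "s \<in> real ` {..N}" for s
  proof -
    have "f (y(k := s)) = 0"
    proof (rule insert.IH[of "y(k := s)"])
      fix z assume z: "\<And>j. j \<in> S \<Longrightarrow> z j \<in> real ` {..N}" "\<And>j. j \<notin> S \<Longrightarrow> z j = (y(k := s)) j"
      show "f z = 0"
      proof (rule insert.prems(1))
        fix j assume "j \<in> insert k S"
        then show "z j \<in> real ` {..N}" using z insert.hyps s by (cases "j = k") auto
      next
        fix j assume "j \<notin> insert k S"
        then show "z j = p j" using z(2)[of j] insert.prems(2)[of j] by auto
      qed
    qed auto
    then show ?thesis using q by auto
  qed
  then have sub: "real ` {..N} \<subseteq> {s. poly q s = 0}" by auto
  have "q = 0"
  proof (rule ccontr)
    assume "q \<noteq> 0"
    then have "finite {s. poly q s = 0}" "card {s. poly q s = 0} \<le> degree q"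
      by (auto simp: poly_roots_finite card_poly_roots_bound)
    with card_mono[OF _ sub] have "card (real ` {..N}) \<le> N" using q by linarith
    then show False by (simp add: card_image)
  qed
  then show ?case using q(2)[of "y k"] by simp
qed

section \<open>Partial derivatives of polynomial functions\<close>

definition pd :: "'x \<Rightarrow> (('x \<Rightarrow> real) \<Rightarrow> real) \<Rightarrow> ('x \<Rightarrow> real) \<Rightarrow> real" where
  "pd k f x = deriv (\<lambda>t. f (x(k := t))) (x k)"

lemma polyfun_has_pd:
  assumes "f \<in> polyfun X"
  shows "((\<lambda>t. f (x(k := t))) has_field_derivative pd k f (x(k := t))) (at t)"
proof -
  obtain q where "\<And>t. f (x(k := t)) = poly q t" using polyfun_coord[OF assms] by blast
  then have "(\<lambda>t. f (x(k := t))) = poly q" by auto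
  then show ?thesis unfolding pd_def
    by (simp add: DERIV_imp_deriv[OF poly_DERIV] poly_DERIV)
qed

lemma pd_eqI: "((\<lambda>t. f (x(k := t))) has_field_derivative d) (at (x k)) \<Longrightarrow> pd k f x = d"
  unfolding pd_def by (rule DERIV_imp_deriv)

lemma pd_const [simp]: "pd k (\<lambda>_. c) = (\<lambda>_. 0)"
  by (rule ext, rule pd_eqI) simp

lemma pd_var: "pd k (\<lambda>x. x j) = (\<lambda>_. if j = k then 1 else 0)"
  by (rule ext, rule pd_eqI) auto

lemma pd_add:
  assumes "f \<in> polyfun X" "g \<in> polyfun X"
  shows "pd k (\<lambda>x. f x + g x) = (\<lambda>x. pd k f x + pd k g x)"
proof (rule ext, rule pd_eqI)
  fix x
  show "((\<lambda>t. f (x(k := t)) + g (x(k := t))) has_field_derivative pd k f x + pd k g x) (at (x k))"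
    using polyfun_has_pd[OF assms(1), of x k "x k"] polyfun_has_pd[OF assms(2), of x k "x k"]
    by (auto intro: DERIV_add)
qed

lemma pd_mult:
  assumes "f \<in> polyfun X" "g \<in> polyfun X"
  shows "pd k (\<lambda>x. f x * g x) = (\<lambda>x. pd k f x * g x + f x * pd k g x)"
proof (rule ext, rule pd_eqI)
  fix x
  show "((\<lambda>t. f (x(k := t)) * g (x(k := t))) has_field_derivative pd k f x * g x + f x * pd k g x) (at (x k))"
    using DERIV_mult[OF polyfun_has_pd[OF assms(1), of x k "x k"] polyfun_has_pd[OF assms(2), of x k "x k"]]
    by (simp add: algebra_simps)
qed

lemma pd_polyfun: "f \<in> polyfun X \<Longrightarrow> pd k f \<in> polyfun X"
  by (induction rule: polyfun.induct) (auto simp: pd_var pd_add pd_mult intro: polyfun_intros)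

lemma pd_commute: "f \<in> polyfun X \<Longrightarrow> pd j (pd k f) = pd k (pd j f)"
proof (induction rule: polyfun.induct)
  case (polyfun_add f g)
  then show ?case by (simp add: pd_add[where X=X] pd_polyfun)
next
  case (polyfun_mult f g)
  then show ?case
    by (simp add: pd_add[where X=X] pd_mult[where X=X] pd_polyfun polyfun.polyfun_mult algebra_simps)
qed (auto simp: pd_var)

section \<open>Homogeneous linear systems with polynomial coefficients\<close>

text \<open>Gaussian elimination without fractions: each step removes the equation \<open>b\<close>
  together with a pivot unknown \<open>a0\<close>.\<close>

lemma polyfun_homogeneous_system:
  assumes "finite B" "finite A" "card B < card A"
    and "\<And>a b. a \<in> A \<Longrightarrow> b \<in> B \<Longrightarrow> M a b \<in> polyfun X"
  shows "\<exists>c. (\<forall>a\<in>A. c a \<in> polyfun X) \<and> (\<exists>a\<in>A. \<exists>x. c a x \<noteq> 0) \<and>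
             (\<forall>b\<in>B. \<forall>x. (\<Sum>a\<in>A. c a x * M a b x) = 0)"
  using assms
proof (induction B arbitrary: A M rule: finite_induct)
  case empty
  then have "A \<noteq> {}" by auto
  then show ?case by (intro exI[of _ "\<lambda>_ _. 1"]) (auto intro: polyfun_const)
next
  case (insert b B)
  show ?case
  proof (cases "\<forall>a\<in>A. \<forall>x. M a b x = 0")
    case True
    have "card B < card A" using insert by auto
    then obtain c where "\<forall>a\<in>A. c a \<in> polyfun X" "\<exists>a\<in>A. \<exists>x. c a x \<noteq> 0"
        "\<forall>b\<in>B. \<forall>x. (\<Sum>a\<in>A. c a x * M a b x) = 0"
      using insert.IH[of A M] insert.prems by auto
    then show ?thesis using True by (intro exI[of _ c]) auto
  next
    case False
    then obtain a0 x0 where a0: "a0 \<in> A" "M a0 b x0 \<noteq> 0" by auto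
    define A' where "A' = A - {a0}"
    \<comment> \<open>Cross-multiplication with the pivot \<open>M a0 b\<close> keeps the new
      entries polynomial.\<close>
    define M' where "M' a b' = (\<lambda>x. M a0 b x * M a b' x - M a b x * M a0 b' x)" for a b'
    have A: "A = insert a0 A'" "a0 \<notin> A'" "finite A'" using a0 insert.prems by (auto simp: A'_def)
    have "card B < card A'" using insert A by auto
    moreover have "M' a b' \<in> polyfun X" if "a \<in> A'" "b' \<in> B" for a b'
      unfolding M'_def using that A insert.prems(3) by (auto intro!: polyfun_diff polyfun_mult)
    ultimately obtain c where c: "\<forall>a\<in>A'. c a \<in> polyfun X" "\<exists>a\<in>A'. \<exists>x. c a x \<noteq> 0"
        "\<forall>b\<in>B. \<forall>x. (\<Sum>a\<in>A'. c a x * M' a b x) = 0"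
      using insert.IH[of A' M'] A by auto
    \<comment> \<open>Back-substitution: the solution is scaled by the pivot, and \<open>a0\<close>
      is solved from equation \<open>b\<close>.\<close>
    define c' where "c' a = (if a = a0 then (\<lambda>x. - (\<Sum>a\<in>A'. c a x * M a b x))
       else (\<lambda>x. c a x * M a0 b x))" for a
    have c': "(\<Sum>a\<in>A. c' a x * f a) = (\<Sum>a\<in>A'. c a x * (M a0 b x * f a - M a b x * f a0))" for x f
    proof -
      have "(\<Sum>a\<in>A'. c' a x * f a) = (\<Sum>a\<in>A'. c a x * M a0 b x * f a)"
        using A by (intro sum.cong) (auto simp: c'_def)
      then show ?thesis
        using A by (simp add: c'_def algebra_simps sum_subtractf sum_distrib_left sum_distrib_right)
    qed
    show ?thesis
    proof (intro exI[of _ c'] conjI ballI allI)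
      fix a assume "a \<in> A"
      then show "c' a \<in> polyfun X"
        unfolding c'_def using c(1) A insert.prems(3)
        by (auto intro!: polyfun_uminus polyfun_sum polyfun_mult)
    next
      obtain a y where a: "a \<in> A'" "c a y \<noteq> 0" using c by auto
      \<comment> \<open>Scaling by the pivot does not annihilate a nonzero coefficient.\<close>
      obtain z where "c a z \<noteq> 0" "M a0 b z \<noteq> 0"
        using polyfun_common_nonzero[of "c a" X "M a0 b" y x0] a a0 c(1) insert.prems(3) by auto
      then show "\<exists>a\<in>A. \<exists>x. c' a x \<noteq> 0"
        using a A by (intro bexI[of _ a] exI[of _ z]) (auto simp: c'_def)
    next
      fix b' x assume "b' \<in> insert b B"
      then show "(\<Sum>a\<in>A. c' a x * M a b' x) = 0"
        unfolding c'[of x "\<lambda>a. M a b' x"] using c(3) by (cases "b' = b") (auto simp: M'_def)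
    qed
  qed
qed

text \<open>Constants are polynomial functions in no variables; a polynomial solution is evaluated
  at a point where some coefficient is nonzero.\<close>

lemma real_homogeneous_system:
  fixes M :: "'a \<Rightarrow> 'b \<Rightarrow> real"
  assumes "finite B" "finite A" "card B < card A"
  shows "\<exists>c. (\<exists>a\<in>A. c a \<noteq> 0) \<and> (\<forall>b\<in>B. (\<Sum>a\<in>A. c a * M a b) = 0)"
proof -
  have "\<exists>c. (\<forall>a\<in>A. c a \<in> polyfun ({} :: unit set)) \<and> (\<exists>a\<in>A. \<exists>x. c a x \<noteq> 0) \<and>
      (\<forall>b\<in>B. \<forall>x. (\<Sum>a\<in>A. c a x * M a b) = 0)"
    by (rule polyfun_homogeneous_system[OF assms]) (rule polyfun_const)
  then obtain c a x where c: "a \<in> A" "c a x \<noteq> 0"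
      "\<forall>b\<in>B. \<forall>x :: unit \<Rightarrow> real. (\<Sum>a\<in>A. c a x * M a b) = 0"
    by (elim exE conjE bexE)
  show ?thesis
  proof (intro exI[of _ "\<lambda>a. c a x"] conjI)
    show "\<exists>a\<in>A. c a x \<noteq> 0" using c(1,2) by (rule bexI[rotated])
    show "\<forall>b\<in>B. (\<Sum>a\<in>A. c a x * M a b) = 0" using c(3) by simp
  qed
qed

section \<open>The Jacobian criterion\<close>

definition slice :: "'x set \<Rightarrow> ('x \<Rightarrow> real) \<Rightarrow> ('x \<Rightarrow> real) set" where
  "slice S p = {x. \<forall>k. k \<notin> S \<longrightarrow> x k = p k}"

text \<open>Vanishing to order \<open>s\<close> along \<open>L\<close>: all iterated partial
  derivatives of order at most \<open>s\<close> in directions of \<open>X\<close>.\<close>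

primrec vanishing :: "'x set \<Rightarrow> ('x \<Rightarrow> real) set \<Rightarrow> nat \<Rightarrow> (('x \<Rightarrow> real) \<Rightarrow> real) \<Rightarrow> bool" where
  "vanishing X L 0 f \<longleftrightarrow> (\<forall>x\<in>L. f x = 0)"
| "vanishing X L (Suc s) f \<longleftrightarrow> (\<forall>x\<in>L. f x = 0) \<and> (\<forall>k\<in>X. vanishing X L s (pd k f))"

lemma vanishing_zero: "vanishing X L s f \<Longrightarrow> x \<in> L \<Longrightarrow> f x = 0"
  by (cases s) auto

lemma vanishing_Suc: "vanishing X L (Suc s) f \<Longrightarrow> vanishing X L s f"
  by (induction s arbitrary: f) auto

lemma vanishing_const: "vanishing X L s (\<lambda>_. 0)"
  by (induction s) auto

lemma vanishing_add:
  assumes "vanishing X L s f" "vanishing X L s g" "f \<in> polyfun X" "g \<in> polyfun X"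
  shows "vanishing X L s (\<lambda>x. f x + g x)"
  using assms by (induction s arbitrary: f g) (auto simp: pd_add pd_polyfun)

lemma vanishing_mult:
  assumes "vanishing X L s g" "f \<in> polyfun X" "g \<in> polyfun X"
  shows "vanishing X L s (\<lambda>x. f x * g x)"
  using assms
proof (induction s arbitrary: f g)
  case (Suc s)
  then have "vanishing X L s g" using vanishing_Suc by blast
  then show ?case using Suc
    by (auto simp: pd_mult intro!: vanishing_add polyfun_mult pd_polyfun)
qed auto

lemma vanishing_sum:
  assumes "\<And>a. a \<in> A \<Longrightarrow> vanishing X L s (f a)" "\<And>a. a \<in> A \<Longrightarrow> f a \<in> polyfun X"
  shows "vanishing X L s (\<lambda>x. \<Sum>a\<in>A. f a x)"
  using assms
proof (induction A rule: infinite_finite_induct)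
  case (insert a A)
  then have "vanishing X L s (\<lambda>x. f a x + (\<Sum>a\<in>A. f a x))"
    by (intro vanishing_add polyfun_sum) auto
  then show ?case using insert.hyps by simp
qed (auto intro: vanishing_const)

text \<open>A direction in \<open>S\<close> stays inside the slice, so \<open>pd l\<close> of a
  function that is zero there is zero there. As \<open>pd l\<close> commutes with the other partial
  derivatives, no order of vanishing is lost.\<close>

lemma vanishing_pd_along_slice:
  assumes "vanishing X (slice S p) s f" "f \<in> polyfun X" "l \<in> S"
  shows "vanishing X (slice S p) s (pd l f)"
proof -
  have z: "\<forall>x\<in>slice S p. pd l f x = 0" if f0: "\<forall>x\<in>slice S p. f x = 0" for f
  proof
    fix x assume "x \<in> slice S p"
    then have "(\<lambda>t. f (x(l := t))) = (\<lambda>_. 0)" using f0 \<open>l \<in> S\<close> by (auto simp: slice_def)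
    then show "pd l f x = 0" by (simp add: pd_def)
  qed
  show ?thesis using assms(1,2)
    by (induction s arbitrary: f) (auto simp: z pd_commute[of _ X _ l] pd_polyfun)
qed

text \<open>As \<open>M p\<close> is nonzero, \<open>M\<close> is not identically zero on the slice,
  where polynomials have no zero divisors. Higher orders use
  \<open>M * pd k f = pd k (M * f) - pd k M * f\<close>.\<close>

lemma vanishing_cancel:
  assumes "vanishing X (slice S p) s (\<lambda>x. M x * f x)" "M \<in> polyfun X" "f \<in> polyfun X" "M p \<noteq> 0"
  shows "vanishing X (slice S p) s f"
  using assms(1,3)
proof (induction s arbitrary: f)
  case 0
  have "f x = 0" if "x \<in> slice S p" for x
  proof (rule ccontr)
    assume "f x \<noteq> 0"
    then obtain z where "M z \<noteq> 0" "f z \<noteq> 0" "\<And>i. p i = x i \<Longrightarrow> z i = p i"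
      using polyfun_common_nonzero[of M X f p x] assms(2,4) 0(2) by auto
    \<comment> \<open>The point \<open>z\<close> agrees with \<open>p\<close> wherever
      \<open>x\<close> does, in particular off \<open>S\<close>.\<close>
    moreover from this(3) have "z \<in> slice S p" using that by (auto simp: slice_def)
    ultimately show False using 0(1) by auto
  qed
  then show ?case by auto
next
  case (Suc s)
  have f: "vanishing X (slice S p) s f" using Suc.IH Suc.prems vanishing_Suc by blast
  have "vanishing X (slice S p) s (pd k f)" if "k \<in> X" for k
  proof (rule Suc.IH)
    have "vanishing X (slice S p) s (\<lambda>x. pd k M x * f x + M x * pd k f x)"
      using Suc.prems that assms(2) by (auto simp: pd_mult)
    moreover have "vanishing X (slice S p) s (\<lambda>x. (- pd k M x) * f x)"
      using f Suc.prems assms(2) by (intro vanishing_mult polyfun_uminus pd_polyfun)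
    ultimately have "vanishing X (slice S p) s (\<lambda>x. (pd k M x * f x + M x * pd k f x) + (- pd k M x) * f x)"
      using Suc.prems assms(2) by (intro vanishing_add[of _ _ _ "\<lambda>x. _ x + _ x"] polyfun_intros pd_polyfun)
    then show "vanishing X (slice S p) s (\<lambda>x. M x * pd k f x)" by simp
  qed (use Suc.prems in \<open>simp add: pd_polyfun\<close>)
  then show ?case using vanishing_zero[OF f] by auto
qed

lemma poly_eq_0_if_iterated_pderiv_0:
  fixes q :: "real poly"
  assumes "\<And>n. poly ((pderiv ^^ n) q) a = 0"
  shows "q = 0"
  using assms
proof (induction "degree q" arbitrary: q)
  case 0
  obtain c where "q = [:c:]" using degree_eq_zeroE 0(1) by metis
  then show ?case using 0(2)[of 0] by auto
next
  case (Suc n)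
  have "pderiv q = 0"
    using Suc.hyps(2) Suc.prems[of "Suc _"] by (intro Suc.hyps(1)) (auto simp: degree_pderiv funpow_swap1)
  then have "degree q = 0" by (simp add: pderiv_eq_0_iff)
  then show ?case using Suc.hyps(2) by auto
qed

text \<open>Taylor expansion in coordinate \<open>k\<close> around \<open>p k\<close>: up to
  factorials, the coefficients are iterated derivatives at a point of the smaller slice, where all
  of them vanish.\<close>

lemma vanishing_all_orders_insert:
  assumes "k \<in> X" "f \<in> polyfun X" "\<And>s. vanishing X (slice S p) s f"
  shows "vanishing X (slice (insert k S) p) s f"
proof -
  \<comment> \<open>Order zero is shown for arbitrary \<open>f\<close>, because it is applied
    afterwards to the derivatives of the given function as well.\<close>
  have *: "f x = 0" if f: "f \<in> polyfun X" "\<And>s. vanishing X (slice S p) s f"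
    and x: "x \<in> slice (insert k S) p" for f x
  proof -
    obtain q where q: "\<And>t. f (x(k := t)) = poly q t" using polyfun_coord[OF f(1)] by blast
    have "f' \<in> polyfun X \<and> (\<forall>s. vanishing X (slice S p) s f') \<and> (\<forall>t. f' (x(k := t)) = poly ((pderiv ^^ n) q) t)"
      if "f' = (pd k ^^ n) f" for n f'
      using that
    proof (induction n arbitrary: f')
      case 0
      then have "f' = f" by simp
      then show ?case using f q by (metis funpow_0)
    next
      case (Suc n)
      define h where "h = (pd k ^^ n) f"
      have h: "h \<in> polyfun X" "\<And>s. vanishing X (slice S p) s h"
         "(\<lambda>t. h (x(k := t))) = poly ((pderiv ^^ n) q)"
        using Suc.IH[OF h_def] by (blast intro: ext)+
      have "pd k h (x(k := t)) = poly ((pderiv ^^ Suc n) q) t" for t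
        using h(3) by (simp add: pd_def DERIV_imp_deriv[OF poly_DERIV])
      moreover have "vanishing X (slice S p) s (pd k h)" for s
        using h(2)[of "Suc s"] assms(1) by auto
      moreover have f': "f' = pd k h" using Suc.prems by (simp add: h_def)
      ultimately show ?case unfolding f' by (intro conjI allI pd_polyfun h(1))
    qed
    moreover have "x(k := p k) \<in> slice S p" using x by (auto simp: slice_def)
    ultimately have "poly ((pderiv ^^ n) q) (p k) = 0" for n
      using vanishing_zero by metis
    then have "q = 0" by (rule poly_eq_0_if_iterated_pderiv_0)
    then show ?thesis using q[of "x k"] by simp
  qed
  show ?thesis using assms(2,3)
  proof (induction s arbitrary: f)
    case 0
    then show ?case using * by auto
  next
    case (Suc s)
    have "vanishing X (slice (insert k S) p) s (pd j f)" if "j \<in> X" for j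
      using Suc.prems(2)[of "Suc _"] that by (intro Suc.IH) (auto simp: pd_polyfun Suc.prems)
    then show ?case using * Suc.prems by auto
  qed
qed

text \<open>The directions of \<open>X\<close> are added to the slice one by one, until all
  coordinates that \<open>f\<close> reads are free.\<close>

lemma vanishing_all_orders_imp_zero:
  assumes "finite X" "f \<in> polyfun X" "\<And>s. vanishing X (slice S p) s f"
  shows "f x = 0"
proof -
  have "Y \<subseteq> X \<Longrightarrow> vanishing X (slice (Y \<union> S) p) s f" if "finite Y" for Y s
    using that
  proof (induction Y arbitrary: s rule: finite_induct)
    case (insert k Y)
    then show ?case using vanishing_all_orders_insert[of k X f "Y \<union> S" p] assms(2) by auto
  qed (use assms in auto)
  from this[OF assms(1), of 0] have "\<forall>y\<in>slice (X \<union> S) p. f y = 0" by auto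
  moreover have "(\<lambda>k. if k \<in> X then x k else p k) \<in> slice (X \<union> S) p" by (auto simp: slice_def)
  moreover have "f (\<lambda>k. if k \<in> X then x k else p k) = f x"
    by (rule polyfun_cong[OF assms(2)]) auto
  ultimately show ?thesis by auto
qed

section \<open>Functions annihilated by a derivation\<close>

text \<open>The polynomial kernel of the derivation
  \<open>M * pd k - (\<Sum>l\<in>S. c l * pd l)\<close>. By the Leibniz rule it is a ring, so once
  it contains the \<open>F e\<close> it contains every \<open>Q(F)\<close>.\<close>

definition derivation_kernel ::
    "'x set \<Rightarrow> (('x \<Rightarrow> real) \<Rightarrow> real) \<Rightarrow> 'x \<Rightarrow> 'x set \<Rightarrow> ('x \<Rightarrow> ('x \<Rightarrow> real) \<Rightarrow> real) \<Rightarrow> (('x \<Rightarrow> real) \<Rightarrow> real) set"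
  where "derivation_kernel X M k S c =
    {h \<in> polyfun X. \<forall>x. M x * pd k h x = (\<Sum>l\<in>S. c l x * pd l h x)}"

lemma derivation_kernel_const: "(\<lambda>_. a) \<in> derivation_kernel X M k S c"
  by (simp add: derivation_kernel_def polyfun_const)

lemma derivation_kernel_add:
  assumes "f \<in> derivation_kernel X M k S c" "g \<in> derivation_kernel X M k S c"
  shows "(\<lambda>x. f x + g x) \<in> derivation_kernel X M k S c"
  using assms
  by (simp add: derivation_kernel_def polyfun_add pd_add[where X=X] distrib_left sum.distrib)

lemma derivation_kernel_mult:
  assumes "f \<in> derivation_kernel X M k S c" "g \<in> derivation_kernel X M k S c"
  shows "(\<lambda>x. f x * g x) \<in> derivation_kernel X M k S c"
proof -
  have fg: "f \<in> polyfun X" "g \<in> polyfun X" using assms by (auto simp: derivation_kernel_def)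
  have "M x * pd k (\<lambda>x. f x * g x) x = (\<Sum>l\<in>S. c l x * pd l (\<lambda>x. f x * g x) x)" for x
  proof -
    have "M x * pd k (\<lambda>x. f x * g x) x = (M x * pd k f x) * g x + f x * (M x * pd k g x)"
      by (simp add: pd_mult[OF fg] algebra_simps)
    also have "\<dots> = (\<Sum>l\<in>S. c l x * pd l f x) * g x + f x * (\<Sum>l\<in>S. c l x * pd l g x)"
      using assms by (simp add: derivation_kernel_def)
    also have "\<dots> = (\<Sum>l\<in>S. c l x * pd l (\<lambda>x. f x * g x) x)"
      by (simp add: pd_mult[OF fg] sum_distrib_left sum_distrib_right sum.distrib[symmetric] algebra_simps)
    finally show ?thesis .
  qed
  then show ?thesis using fg by (simp add: derivation_kernel_def polyfun_mult)
qed

lemma derivation_kernel_sum: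
  "(\<And>a. a \<in> A \<Longrightarrow> f a \<in> derivation_kernel X M k S c) \<Longrightarrow>
    (\<lambda>x. \<Sum>a\<in>A. f a x) \<in> derivation_kernel X M k S c"
  by (induction A rule: infinite_finite_induct) (auto intro: derivation_kernel_const derivation_kernel_add)

lemma derivation_kernel_prod:
  "(\<And>a. a \<in> A \<Longrightarrow> f a \<in> derivation_kernel X M k S c) \<Longrightarrow>
    (\<lambda>x. \<Prod>a\<in>A. f a x) \<in> derivation_kernel X M k S c"
  by (induction A rule: infinite_finite_induct) (auto intro: derivation_kernel_const derivation_kernel_mult)

lemma derivation_kernel_power:
  "f \<in> derivation_kernel X M k S c \<Longrightarrow> (\<lambda>x. f x ^ n) \<in> derivation_kernel X M k S c"
  by (induction n) (auto intro: derivation_kernel_const derivation_kernel_mult)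

text \<open>The order of vanishing along the slice raises itself: derivatives along \<open>S\<close>
  keep order \<open>s\<close>, a transversal one is a combination of them after multiplication by
  \<open>M k\<close>, and \<open>M k p \<noteq> 0\<close> permits cancelling this factor.\<close>

lemma zero_on_slice_imp_zero:
  assumes "finite X" "S \<subseteq> X" "g \<in> polyfun X" "\<And>x. x \<in> slice S p \<Longrightarrow> g x = 0"
    and g: "\<And>k. k \<in> X - S \<Longrightarrow> g \<in> derivation_kernel X (M k) k S (c k)"
    and M: "\<And>k. k \<in> X - S \<Longrightarrow> M k \<in> polyfun X" "\<And>k. k \<in> X - S \<Longrightarrow> M k p \<noteq> 0"
    and c: "\<And>k l. k \<in> X - S \<Longrightarrow> l \<in> S \<Longrightarrow> c k l \<in> polyfun X"
  shows "g x = 0"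
proof -
  have "vanishing X (slice S p) s g" for s
  proof (induction s)
    case 0
    then show ?case using assms(4) by auto
  next
    case (Suc s)
    have "vanishing X (slice S p) s (pd k g)" if k: "k \<in> X" for k
    proof (cases "k \<in> S")
      case True
      then show ?thesis using vanishing_pd_along_slice[OF Suc assms(3)] by auto
    next
      case False
      with k have k: "k \<in> X - S" by auto
      have "vanishing X (slice S p) s (\<lambda>x. \<Sum>l\<in>S. c k l x * pd l g x)"
        using vanishing_pd_along_slice[OF Suc assms(3)] c[OF k] assms(3)
        by (intro vanishing_sum vanishing_mult polyfun_mult pd_polyfun) auto
      then have "vanishing X (slice S p) s (\<lambda>x. M k x * pd k g x)"
        using g[OF k] by (simp add: derivation_kernel_def)
      then show ?thesis using M[OF k] assms(3) by (auto intro: vanishing_cancel pd_polyfun)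
    qed
    then show ?case using assms(4) by auto
  qed
  then show ?thesis by (rule vanishing_all_orders_imp_zero[OF assms(1,3)])
qed

text \<open>Evaluation on a grid gives fewer linear conditions than there are coefficients.\<close>

lemma relation_on_slice:
  assumes "finite E" "finite S" "card S < card E" "\<And>e. e \<in> E \<Longrightarrow> F e \<in> polyfun X"
  shows "\<exists>D c. (\<exists>\<mu>\<in>E \<rightarrow>\<^sub>E {..D}. c \<mu> \<noteq> 0) \<and>
    (\<forall>x\<in>slice S p. (\<Sum>\<mu>\<in>E \<rightarrow>\<^sub>E {..D}. c \<mu> * (\<Prod>e\<in>E. F e x ^ \<mu> e)) = 0)"
proof -
  obtain N where N: "\<And>e. e \<in> E \<Longrightarrow> coord_degree_le (N e) (F e)"
    using bchoice[of E "\<lambda>e N. coord_degree_le N (F e)"] polyfun_coord_degree[OF assms(4)] by auto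
  define \<delta> where "\<delta> = sum N E"
  have \<delta>: "coord_degree_le \<delta> (F e)" if "e \<in> E" for e
    using coord_degree_le_mono[OF N[OF that]] that assms(1) by (simp add: \<delta>_def member_le_sum)
  \<comment> \<open>\<open>K\<close> bounds the coordinate degrees of monomials in the
    \<open>F e\<close> with exponents at most \<open>D\<close>. As
    \<open>K + 1 \<le> C * (D + 1)\<close>, the choice \<open>D = C ^ card S\<close> makes the grid
    of side \<open>K + 1\<close> smaller than the number \<open>(D + 1) ^ card E\<close> of
    coefficients.\<close>
  define C where "C = card E * \<delta> + 1"
  define D where "D = C ^ card S"
  define K where "K = card E * (D * \<delta>)"
  define pt where "pt y = (\<lambda>k. if k \<in> S then real (y k) else p k)" for y
  have "K + 1 \<le> C * (D + 1)" by (simp add: K_def C_def algebra_simps)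
  then have "(K + 1) ^ card S \<le> (C * (D + 1)) ^ card S" by (rule power_mono) auto
  also have "\<dots> = D * (D + 1) ^ card S" by (subst power_mult_distrib) (simp add: D_def)
  also have "\<dots> < (D + 1) ^ Suc (card S)" by simp
  also have "\<dots> \<le> (D + 1) ^ card E" using assms(3) by (intro power_increasing) auto
  finally have "card (S \<rightarrow>\<^sub>E {..K}) < card (E \<rightarrow>\<^sub>E {..D})"
    using assms(1,2) by (simp add: card_PiE)
  then obtain c where c: "\<exists>\<mu>\<in>E \<rightarrow>\<^sub>E {..D}. c \<mu> \<noteq> 0"
      "\<forall>y\<in>S \<rightarrow>\<^sub>E {..K}. (\<Sum>\<mu>\<in>E \<rightarrow>\<^sub>E {..D}. c \<mu> * (\<Prod>e\<in>E. F e (pt y) ^ \<mu> e)) = 0"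
    using real_homogeneous_system[of "S \<rightarrow>\<^sub>E {..K}" "E \<rightarrow>\<^sub>E {..D}" "\<lambda>\<mu> y. \<Prod>e\<in>E. F e (pt y) ^ \<mu> e"]
      assms(1,2) by (auto simp: finite_PiE)
  define g where "g x = (\<Sum>\<mu>\<in>E \<rightarrow>\<^sub>E {..D}. c \<mu> * (\<Prod>e\<in>E. F e x ^ \<mu> e))" for x
  have "coord_degree_le (0 + K) (\<lambda>x. c \<mu> * (\<Prod>e\<in>E. F e x ^ \<mu> e))" if "\<mu> \<in> E \<rightarrow>\<^sub>E {..D}" for \<mu>
    unfolding K_def using that
    by (intro coord_degree_le_mult coord_degree_le_const coord_degree_le_prod
        coord_degree_le_mono[OF coord_degree_le_power[OF \<delta>]]) auto
  then have "coord_degree_le K g" unfolding g_def by (auto intro!: coord_degree_le_sum)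
  have "g x = 0" if "x \<in> slice S p" for x
  proof (rule zero_on_grid_imp_zero_on_slice[OF assms(2) \<open>coord_degree_le K g\<close>])
    fix y assume y: "\<And>k. k \<in> S \<Longrightarrow> y k \<in> real ` {..K}" "\<And>k. k \<notin> S \<Longrightarrow> y k = p k"
    define y' where "y' = restrict (\<lambda>k. nat \<lfloor>y k\<rfloor>) S"
    have "pt y' = y" using y by (force simp: pt_def y'_def)
    moreover have "y' \<in> S \<rightarrow>\<^sub>E {..K}" using y by (force simp: y'_def)
    ultimately show "g y = 0" using c(2) by (force simp: g_def)
  qed (use that in \<open>auto simp: slice_def\<close>)
  then show ?thesis using c(1) unfolding g_def by blast
qed

text \<open>At \<open>p\<close> the rows of the Jacobian are linearly independent. With
  \<open>S\<close> a maximal set of columns independent over the rational functions, fewer columns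
  than rows would produce a relation among the \<open>F e\<close>; otherwise every unit vector is,
  up to a nonzero polynomial factor, a combination of columns.\<close>

theorem jacobian_criterion:
  assumes "finite X" "finite E" "\<And>e. e \<in> E \<Longrightarrow> F e \<in> polyfun X"
    and indep: "\<And>D c \<mu>. \<lbrakk>\<forall>x. (\<Sum>\<mu>\<in>E \<rightarrow>\<^sub>E {..D::nat}. c \<mu> * (\<Prod>e\<in>E. F e x ^ \<mu> e)) = 0; \<mu> \<in> E \<rightarrow>\<^sub>E {..D}\<rbrakk>
      \<Longrightarrow> c \<mu> = 0"
  shows "\<exists>p. \<forall>\<omega>. (\<forall>k\<in>X. (\<Sum>e\<in>E. \<omega> e * pd k (F e) p) = 0) \<longrightarrow> (\<forall>e\<in>E. \<omega> e = 0)"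
proof -
  \<comment> \<open>\<open>rel\<close> is a linear relation among the columns \<open>S\<close> of
    the Jacobian with rows \<open>E\<close>; \<open>ind\<close> is independence over the rational
    functions, with denominators cleared.\<close>
  define rel where "rel S a \<longleftrightarrow> (\<forall>l\<in>S. a l \<in> polyfun X) \<and>
      (\<forall>e\<in>E. \<forall>x. (\<Sum>l\<in>S. a l x * pd l (F e) x) = 0)" for S a
  define ind where "ind S \<longleftrightarrow> S \<subseteq> X \<and> (\<forall>a. rel S a \<longrightarrow> (\<forall>l\<in>S. \<forall>x. a l x = 0))" for S
  have "finite {S. ind S}" by (rule finite_subset[of _ "Pow X"]) (auto simp: ind_def assms(1))
  moreover have "{} \<in> {S. ind S}" by (auto simp: ind_def)
  ultimately obtain S where S: "ind S" "\<And>S'. ind S' \<Longrightarrow> S \<subseteq> S' \<Longrightarrow> S = S'"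
    using finite_has_maximal[of "{S. ind S}"] by blast
  have SX: "S \<subseteq> X" and fS: "finite S" using S(1) assms(1) finite_subset by (auto simp: ind_def)
  have S0: "a l x = 0" if "\<And>l. l \<in> S \<Longrightarrow> a l \<in> polyfun X"
    "\<And>e x. e \<in> E \<Longrightarrow> (\<Sum>l\<in>S. a l x * pd l (F e) x) = 0" "l \<in> S" for a l x
  proof -
    have "rel S a" using that(1,2) by (auto simp: rel_def)
    then show ?thesis using S(1) that(3) by (auto simp: ind_def)
  qed
  have pdF: "pd k (F e) \<in> polyfun X" if "e \<in> E" for k e
    using that by (simp add: assms(3) pd_polyfun)
  show ?thesis
  proof (cases "card S < card E")
    case True
    \<comment> \<open>A dependence of column \<open>k\<close> on the columns \<open>S\<close> with
      common denominator \<open>M\<close>; maximality of \<open>S\<close> supplies one for each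
      \<open>k\<close> outside \<open>S\<close>.\<close>
    define good where "good k M c \<longleftrightarrow> M \<in> polyfun X \<and> (\<exists>x. M x \<noteq> 0) \<and> (\<forall>l\<in>S. c l \<in> polyfun X) \<and>
        (\<forall>e\<in>E. F e \<in> derivation_kernel X M k S c)" for k M c
    have "\<exists>M c. good k M c" if k: "k \<in> X - S" for k
    proof -
      have "\<not> ind (insert k S)" using S(2)[of "insert k S"] k by auto
      then obtain a l0 x0 where rel: "rel (insert k S) a" and l0: "l0 \<in> insert k S" "a l0 x0 \<noteq> 0"
        using k SX unfolding ind_def by auto
      then have a: "\<forall>l\<in>insert k S. a l \<in> polyfun X"
        "\<forall>e\<in>E. \<forall>x. (\<Sum>l\<in>insert k S. a l x * pd l (F e) x) = 0"
        by (auto simp: rel_def)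
      have a2: "a k x * pd k (F e) x + (\<Sum>l\<in>S. a l x * pd l (F e) x) = 0" if "e \<in> E" for e x
        using a(2) k fS that by auto
      have "\<exists>x. a k x \<noteq> 0"
      proof (rule ccontr)
        assume "\<not> ?thesis"
        then have z: "a k x = 0" for x by auto
        have "a l0 x0 = 0" if "l0 \<in> S"
          using S0[of a l0 x0] a(1) a2 z that by auto
        then show False using l0 z by auto
      qed
      moreover have "F e \<in> derivation_kernel X (a k) k S (\<lambda>l x. - a l x)" if "e \<in> E" for e
        using a2[OF that] assms(3)[OF that]
        by (auto simp: derivation_kernel_def sum_negf eq_neg_iff_add_eq_0)
      ultimately show ?thesis using a(1)
        by (intro exI[of _ "a k"] exI[of _ "\<lambda>l x. - a l x"]) (auto simp: good_def intro: polyfun_uminus)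
    qed
    then obtain M c where "\<And>k. k \<in> X - S \<Longrightarrow> good k (M k) (c k)" by metis
    then have M: "\<And>k. k \<in> X - S \<Longrightarrow> M k \<in> polyfun X" "\<And>k. k \<in> X - S \<Longrightarrow> \<exists>x. M k x \<noteq> 0"
      and c: "\<And>k l. k \<in> X - S \<Longrightarrow> l \<in> S \<Longrightarrow> c k l \<in> polyfun X"
      and F: "\<And>k e. k \<in> X - S \<Longrightarrow> e \<in> E \<Longrightarrow> F e \<in> derivation_kernel X (M k) k S (c k)"
      by (auto simp: good_def)
    \<comment> \<open>The slice is taken through a point at which no denominator vanishes.\<close>
    obtain p where p: "\<And>k. k \<in> X - S \<Longrightarrow> M k p \<noteq> 0"
      using polyfun_finite_nonzero[of "X - S" M X] M assms(1) by auto
    obtain D b \<mu> where b: "\<mu> \<in> E \<rightarrow>\<^sub>E {..D}" "b \<mu> \<noteq> 0"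
      "\<forall>x\<in>slice S p. (\<Sum>\<mu>\<in>E \<rightarrow>\<^sub>E {..D::nat}. b \<mu> * (\<Prod>e\<in>E. F e x ^ \<mu> e)) = 0"
      using relation_on_slice[OF assms(2) fS True, of F X p] assms(3) by blast
    define g where "g x = (\<Sum>\<mu>\<in>E \<rightarrow>\<^sub>E {..D}. b \<mu> * (\<Prod>e\<in>E. F e x ^ \<mu> e))" for x
    have "g x = 0" for x
    proof (rule zero_on_slice_imp_zero[OF assms(1) SX, where g=g and p=p and M=M and c=c])
      show "g \<in> polyfun X" unfolding g_def using assms(3)
        by (intro polyfun_sum polyfun_mult polyfun_const polyfun_prod polyfun_power)
      show "g \<in> derivation_kernel X (M k) k S (c k)" if "k \<in> X - S" for k
        unfolding g_def using F[OF that]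
        by (intro derivation_kernel_sum derivation_kernel_mult derivation_kernel_const
            derivation_kernel_prod derivation_kernel_power)
    qed (use M p c b(3) in \<open>auto simp: g_def\<close>)
    then have "b \<mu> = 0" using indep[where c=b and D=D and \<mu>=\<mu>] b(1) unfolding g_def by blast
    then show ?thesis using b(2) by simp
  next
    case False
    \<comment> \<open>A combination of the columns \<open>S\<close> that equals \<open>- b\<close>
      times the unit vector of \<open>e0\<close>.\<close>
    define good where "good e0 b a \<longleftrightarrow> b \<in> polyfun X \<and> (\<exists>x. b x \<noteq> 0) \<and>
        (\<forall>e\<in>E. \<forall>x. (if e = e0 then b x else 0) + (\<Sum>l\<in>S. a l x * pd l (F e) x) = 0)" for e0 b a
    have "\<exists>b a. good e0 b a" if "e0 \<in> E" for e0
    proof -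
      \<comment> \<open>The unknowns are the coefficients of the columns \<open>S\<close> and, as
        \<open>None\<close>, the factor of the unit vector: \<open>card S + 1\<close> unknowns for
        \<open>card E \<le> card S\<close> equations.\<close>
      define A where "A = insert None (Some ` S)"
      define M where "M a e = (case a of None \<Rightarrow> (\<lambda>_. if e = e0 then 1 else 0) | Some l \<Rightarrow> pd l (F e))"
        for a e
      have "card E < card A" using False fS by (simp add: A_def card_image)
      moreover have "M a e \<in> polyfun X" if "a \<in> A" "e \<in> E" for a e
        using that pdF by (auto simp: M_def A_def split: option.splits intro: polyfun_const)
      ultimately obtain c where c: "\<forall>a\<in>A. c a \<in> polyfun X" "\<exists>a\<in>A. \<exists>x. c a x \<noteq> 0"
          "\<forall>e\<in>E. \<forall>x. (\<Sum>a\<in>A. c a x * M a e x) = 0"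
        using polyfun_homogeneous_system[of E A M X] fS assms(2) by (auto simp: A_def)
      have c3: "(if e = e0 then c None x else 0) + (\<Sum>l\<in>S. c (Some l) x * pd l (F e) x) = 0"
        if "e \<in> E" for e x
      proof -
        have "(\<Sum>a\<in>A. c a x * M a e x) =
            (if e = e0 then c None x else 0) + (\<Sum>l\<in>S. c (Some l) x * pd l (F e) x)"
          using fS by (simp add: A_def M_def sum.reindex)
        then show ?thesis using c(3) that by auto
      qed
      \<comment> \<open>Without the unit vector the solution would be a nontrivial relation among
        independent columns.\<close>
      have "\<exists>x. c None x \<noteq> 0"
      proof (rule ccontr)
        assume "\<not> ?thesis"
        then have z: "c None x = 0" for x by auto
        have "(\<Sum>l\<in>S. c (Some l) x * pd l (F e) x) = 0" if "e \<in> E" for e x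
          using c3[OF that, of x] z by (simp split: if_splits)
        then have "c (Some l) x = 0" if "l \<in> S" for l x
          using S0[of "\<lambda>l. c (Some l)" l x] c(1) that by (auto simp: A_def)
        then show False using c(2) z by (auto simp: A_def)
      qed
      then show ?thesis using c(1) c3
        by (intro exI[of _ "c None"] exI[of _ "\<lambda>l. c (Some l)"]) (simp add: good_def A_def)
    qed
    then obtain b a where ba: "\<And>e0. e0 \<in> E \<Longrightarrow> good e0 (b e0) (a e0)" by metis
    then have b: "\<And>e0. e0 \<in> E \<Longrightarrow> b e0 \<in> polyfun X" "\<And>e0. e0 \<in> E \<Longrightarrow> \<exists>x. b e0 x \<noteq> 0"
      by (auto simp: good_def)
    have ba: "(if e = e0 then b e0 x else 0) + (\<Sum>l\<in>S. a e0 l x * pd l (F e) x) = 0"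
      if "e0 \<in> E" "e \<in> E" for e0 e x
      using ba[OF that(1)] that(2) by (simp add: good_def)
    obtain p where p: "\<forall>e\<in>E. b e p \<noteq> 0"
      using polyfun_finite_nonzero[of E b X] assms(2) b by auto
    have "\<omega> e0 = 0" if \<omega>: "\<forall>k\<in>X. (\<Sum>e\<in>E. \<omega> e * pd k (F e) p) = 0" and e0: "e0 \<in> E" for \<omega> e0
    proof -
      \<comment> \<open>Pairing the stress with the combination for \<open>e0\<close> makes the
        columns drop out and leaves \<open>\<omega> e0 * b e0 p = 0\<close>.\<close>
      have "0 = (\<Sum>e\<in>E. \<omega> e * ((if e = e0 then b e0 p else 0) + (\<Sum>l\<in>S. a e0 l p * pd l (F e) p)))"
        using ba[OF e0] by simp
      also have "\<dots> = (\<Sum>e\<in>E. \<omega> e * (if e = e0 then b e0 p else 0)) +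
          (\<Sum>e\<in>E. \<Sum>l\<in>S. a e0 l p * (\<omega> e * pd l (F e) p))"
        by (simp add: distrib_left sum.distrib sum_distrib_left algebra_simps)
      also have "(\<Sum>e\<in>E. \<Sum>l\<in>S. a e0 l p * (\<omega> e * pd l (F e) p)) =
          (\<Sum>l\<in>S. a e0 l p * (\<Sum>e\<in>E. \<omega> e * pd l (F e) p))"
        by (subst sum.swap) (simp add: sum_distrib_left)
      also have "\<dots> = 0" using \<omega> SX by (intro sum.neutral) auto
      also have "(\<Sum>e\<in>E. \<omega> e * (if e = e0 then b e0 p else 0)) = \<omega> e0 * b e0 p"
        using e0 assms(2) by (simp add: if_distrib sum.delta cong: if_cong)
      finally show ?thesis using p e0 by auto
    qed
    then show ?thesis by blast
  qed
qed

section \<open>Evaluation of formal polynomials\<close>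

definition mono_eval :: "('x \<Rightarrow> real) \<Rightarrow> ('x \<Rightarrow>\<^sub>0 nat) \<Rightarrow> real" where
  "mono_eval x m = (\<Prod>v\<in>Poly_Mapping.keys m. x v ^ Poly_Mapping.lookup m v)"

definition reval :: "('x \<Rightarrow> real) \<Rightarrow> 'x rpoly \<Rightarrow> real" where
  "reval x Q = (\<Sum>m\<in>Poly_Mapping.keys Q. Poly_Mapping.lookup Q m * mono_eval x m)"

lemma mono_eval_superset:
  assumes "finite V" "Poly_Mapping.keys m \<subseteq> V"
  shows "mono_eval x m = (\<Prod>v\<in>V. x v ^ Poly_Mapping.lookup m v)"
  unfolding mono_eval_def using assms
  by (intro prod.mono_neutral_left) (auto simp: in_keys_iff)

lemma mono_eval_zero [simp]: "mono_eval x 0 = 1"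
  by (simp add: mono_eval_def)

lemma mono_eval_single [simp]: "mono_eval x (Poly_Mapping.single v n) = x v ^ n"
  using mono_eval_superset[of "{v}" "Poly_Mapping.single v n" x] by (auto split: if_splits)

lemma mono_eval_add: "mono_eval x (m + n) = mono_eval x m * mono_eval x n"
proof -
  define V where "V = Poly_Mapping.keys m \<union> Poly_Mapping.keys n"
  have "finite V" "Poly_Mapping.keys m \<subseteq> V" "Poly_Mapping.keys n \<subseteq> V"
    "Poly_Mapping.keys (m + n) \<subseteq> V"
    using keys_add[of m n] by (auto simp: V_def)
  then show ?thesis
    by (simp add: mono_eval_superset[of V] lookup_add power_add prod.distrib)
qed

lemma reval_superset:
  assumes "finite V" "Poly_Mapping.keys Q \<subseteq> V"
  shows "reval x Q = (\<Sum>m\<in>V. Poly_Mapping.lookup Q m * mono_eval x m)"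
  unfolding reval_def using assms
  by (intro sum.mono_neutral_left) (auto simp: in_keys_iff)

lemma reval_zero [simp]: "reval x 0 = 0"
  by (simp add: reval_def)

lemma reval_single [simp]: "reval x (Poly_Mapping.single m c) = c * mono_eval x m"
  using reval_superset[of "{m}" "Poly_Mapping.single m c" x] by (auto split: if_splits)

lemma reval_add: "reval x (P + Q) = reval x P + reval x Q"
proof -
  define V where "V = Poly_Mapping.keys P \<union> Poly_Mapping.keys Q"
  have "finite V" "Poly_Mapping.keys P \<subseteq> V" "Poly_Mapping.keys Q \<subseteq> V"
    "Poly_Mapping.keys (P + Q) \<subseteq> V"
    using keys_add[of P Q] by (auto simp: V_def)
  then show ?thesis
    by (simp add: reval_superset[of V] lookup_add distrib_right sum.distrib)
qed

lemma reval_diff: "reval x (P - Q) = reval x P - reval x Q"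
  using reval_add[of x "P - Q" Q] by simp

lemma reval_sum: "reval x (\<Sum>a\<in>A. f a) = (\<Sum>a\<in>A. reval x (f a))"
  by (induction A rule: infinite_finite_induct) (auto simp: reval_add)

lemma poly_mapping_sum_singles:
  fixes Q :: "'a \<Rightarrow>\<^sub>0 'b::comm_monoid_add"
  shows "Q = (\<Sum>m\<in>Poly_Mapping.keys Q. Poly_Mapping.single m (Poly_Mapping.lookup Q m))"
proof (rule poly_mapping_eqI)
  fix k
  show "Poly_Mapping.lookup Q k =
      Poly_Mapping.lookup (\<Sum>m\<in>Poly_Mapping.keys Q. Poly_Mapping.single m (Poly_Mapping.lookup Q m)) k"
    by (simp add: lookup_sum lookup_single when_def sum.delta in_keys_iff)
qed

lemma reval_mult: "reval x (P * Q) = reval x P * reval x Q"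
proof -
  have "P * Q = (\<Sum>m\<in>Poly_Mapping.keys P. Poly_Mapping.single m (Poly_Mapping.lookup P m)) *
      (\<Sum>n\<in>Poly_Mapping.keys Q. Poly_Mapping.single n (Poly_Mapping.lookup Q n))"
    by (simp flip: poly_mapping_sum_singles)
  also have "reval x \<dots> = reval x P * reval x Q"
    by (simp add: sum_product reval_sum mult_single mono_eval_add reval_def[of x P] reval_def[of x Q]
        mult_ac)
  finally show ?thesis .
qed

lemma reval_one [simp]: "reval x 1 = 1"
  by (simp flip: single_one)

lemma reval_power: "reval x (P ^ n) = reval x P ^ n"
  by (induction n) (auto simp: reval_mult)

lemma reval_prod: "reval x (\<Prod>a\<in>A. f a) = (\<Prod>a\<in>A. reval x (f a))"
  by (induction A rule: infinite_finite_induct) (auto simp: reval_mult)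

text \<open>Connects formal substitution with composition of functions, so that algebraic
  independence can be tested on values.\<close>

lemma reval_rsubst: "reval x (rsubst g Q) = reval (\<lambda>e. reval x (g e)) Q"
  by (simp add: rsubst_def rconst_def reval_sum reval_mult reval_prod reval_power
      reval_def[of "\<lambda>e. reval x (g e)"] mono_eval_def)

text \<open>Kronecker's substitution: exponent vectors are read as digits in base \<open>B\<close>.\<close>

lemma separating_weights:
  assumes "finite V"
  shows "\<exists>w :: 'x \<Rightarrow> nat. \<forall>m n. (\<forall>v\<in>V. m v < B \<and> n v < B) \<and>
    (\<Sum>v\<in>V. m v * w v) = (\<Sum>v\<in>V. n v * w v) \<longrightarrow> (\<forall>v\<in>V. m v = n v)"
  using assms
proof (induction V rule: finite_induct)
  case (insert u V)
  then obtain w :: "'x \<Rightarrow> nat" where w: "\<And>m n. \<lbrakk>\<forall>v\<in>V. m v < B \<and> n v < B;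
    (\<Sum>v\<in>V. m v * w v) = (\<Sum>v\<in>V. n v * w v)\<rbrakk> \<Longrightarrow> \<forall>v\<in>V. m v = n v" by blast
  \<comment> \<open>\<open>u\<close> becomes the units digit in base \<open>B\<close>, and all other
    digits move up one place.\<close>
  define w' where "w' v = (if v = u then 1 else B * w v)" for v
  have w': "(\<Sum>v\<in>insert u V. m v * w' v) = m u + B * (\<Sum>v\<in>V. m v * w v)" for m :: "'x \<Rightarrow> nat"
  proof -
    have "(\<Sum>v\<in>V. m v * w' v) = (\<Sum>v\<in>V. B * (m v * w v))"
      using insert.hyps by (intro sum.cong) (auto simp: w'_def)
    then show ?thesis using insert.hyps by (simp add: w'_def sum_distrib_left)
  qed
  show ?case
  proof (intro exI[of _ w'] allI impI)
    fix m n :: "'x \<Rightarrow> nat"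
    assume *: "(\<forall>v\<in>insert u V. m v < B \<and> n v < B) \<and>
      (\<Sum>v\<in>insert u V. m v * w' v) = (\<Sum>v\<in>insert u V. n v * w' v)"
    then have eq: "m u + B * (\<Sum>v\<in>V. m v * w v) = n u + B * (\<Sum>v\<in>V. n v * w v)"
      and lt: "m u < B" "n u < B" by (auto simp: w')
    have "(m u + B * (\<Sum>v\<in>V. m v * w v)) mod B = (n u + B * (\<Sum>v\<in>V. n v * w v)) mod B"
      using eq by simp
    then have u: "m u = n u" using lt by simp
    with eq lt have "(\<Sum>v\<in>V. m v * w v) = (\<Sum>v\<in>V. n v * w v)" by simp
    then show "\<forall>v\<in>insert u V. m v = n v" using w * u by auto
  qed
qed auto

text \<open>On the curve \<open>x v = t ^ w v\<close> distinct monomials of \<open>R\<close> become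
  distinct powers of \<open>t\<close>, so the coefficients of \<open>R\<close> are those of a
  univariate polynomial that vanishes everywhere.\<close>

lemma reval_eq_zero_imp:
  fixes R :: "'x rpoly"
  assumes "\<And>x. reval x R = 0"
  shows "R = 0"
proof -
  define K where "K = Poly_Mapping.keys R"
  define V where "V = (\<Union>m\<in>K. Poly_Mapping.keys m)"
  have fin: "finite K" "finite V" by (auto simp: K_def V_def)
  define B where "B = Suc (\<Sum>m\<in>K. \<Sum>v\<in>V. Poly_Mapping.lookup m v)"
  have B: "Poly_Mapping.lookup m v < B" if "m \<in> K" "v \<in> V" for m v
  proof -
    have "Poly_Mapping.lookup m v \<le> (\<Sum>v\<in>V. Poly_Mapping.lookup m v)"
      using that fin by (intro member_le_sum) auto
    also have "\<dots> \<le> (\<Sum>m\<in>K. \<Sum>v\<in>V. Poly_Mapping.lookup m v)"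
      using that fin by (intro member_le_sum[of m K]) auto
    finally show ?thesis by (simp add: B_def)
  qed
  obtain w :: "'x \<Rightarrow> nat" where w: "\<And>m n. \<lbrakk>\<forall>v\<in>V. m v < B \<and> n v < B;
    (\<Sum>v\<in>V. m v * w v) = (\<Sum>v\<in>V. n v * w v)\<rbrakk> \<Longrightarrow> \<forall>v\<in>V. m v = n v"
    using separating_weights[OF fin(2), of B] by blast
  define wt where "wt m = (\<Sum>v\<in>V. Poly_Mapping.lookup m v * w v)" for m
  have inj: "inj_on wt K"
  proof (rule inj_onI)
    fix m n assume mn: "m \<in> K" "n \<in> K" "wt m = wt n"
    then have "\<forall>v\<in>V. Poly_Mapping.lookup m v = Poly_Mapping.lookup n v"
      using B by (intro w) (auto simp: wt_def)
    moreover have "Poly_Mapping.lookup m v = 0 \<and> Poly_Mapping.lookup n v = 0" if "v \<notin> V" for v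
      using mn that by (auto simp: V_def in_keys_iff)
    ultimately show "m = n" by (intro poly_mapping_eqI) metis
  qed
  define q where "q = (\<Sum>m\<in>K. Polynomial.monom (Poly_Mapping.lookup R m) (wt m))"
  have "poly q t = 0" for t
  proof -
    have "mono_eval (\<lambda>v. t ^ w v) m = t ^ wt m" if "m \<in> K" for m
    proof -
      have "mono_eval (\<lambda>v. t ^ w v) m = (\<Prod>v\<in>V. (t ^ w v) ^ Poly_Mapping.lookup m v)"
        using that fin by (intro mono_eval_superset) (auto simp: V_def)
      then show ?thesis by (simp add: wt_def power_sum mult.commute flip: power_mult)
    qed
    then have "reval (\<lambda>v. t ^ w v) R = poly q t"
      by (simp add: reval_def q_def poly_sum poly_monom K_def)
    then show ?thesis using assms by simp
  qed
  then have "q = 0" using poly_all_0_iff_0 by blast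
  have "Poly_Mapping.lookup R m = 0" if m: "m \<in> K" for m
  proof -
    have "0 = coeff q (wt m)" using \<open>q = 0\<close> by simp
    also have "\<dots> = (\<Sum>n\<in>K. if n = m then Poly_Mapping.lookup R n else 0)"
      unfolding q_def coeff_sum using inj m by (intro sum.cong) (auto dest: inj_onD)
    finally show ?thesis using m fin by simp
  qed
  then show ?thesis by (intro poly_mapping_eqI) (auto simp: K_def in_keys_iff)
qed

text \<open>The \<open>c\<close> are the coefficients of a formal polynomial \<open>Q\<close>; its
  substitution is zero at every point, hence formally, and independence gives
  \<open>Q = 0\<close>.\<close>

lemma alg_independent_no_relation:
  assumes "finite I" "alg_independent I g"
    and rel: "\<forall>x. (\<Sum>\<nu>\<in>I \<rightarrow>\<^sub>E {..D::nat}. c \<nu> * (\<Prod>e\<in>I. reval x (g e) ^ \<nu> e)) = 0"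
    and \<mu>: "\<mu> \<in> I \<rightarrow>\<^sub>E {..D}"
  shows "c \<mu> = 0"
proof -
  define mon :: "('a \<Rightarrow> nat) \<Rightarrow> 'a \<Rightarrow>\<^sub>0 nat"
    where "mon \<nu> = (\<Sum>e\<in>I. Poly_Mapping.single e (\<nu> e))" for \<nu>
  have mon: "Poly_Mapping.lookup (mon \<nu>) e = (if e \<in> I then \<nu> e else 0)" for \<nu> e
    using assms(1) by (simp add: mon_def lookup_sum lookup_single when_def sum.delta)
  have keys: "Poly_Mapping.keys (mon \<nu>) \<subseteq> I" for \<nu>
    by (auto simp: in_keys_iff mon split: if_splits)
  have inj: "inj_on mon (I \<rightarrow>\<^sub>E {..D})"
  proof (rule inj_onI)
    fix \<nu> \<nu>' assume *: "\<nu> \<in> I \<rightarrow>\<^sub>E {..D}" "\<nu>' \<in> I \<rightarrow>\<^sub>E {..D}" "mon \<nu> = mon \<nu>'"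
    show "\<nu> = \<nu>'"
    proof (rule PiE_ext[OF *(1,2)])
      fix e assume "e \<in> I"
      then show "\<nu> e = \<nu>' e" using mon[of \<nu> e] mon[of \<nu>' e] *(3) by simp
    qed
  qed
  define Q where "Q = (\<Sum>\<nu>\<in>I \<rightarrow>\<^sub>E {..D}. Poly_Mapping.single (mon \<nu>) (c \<nu>))"
  have fin: "finite (I \<rightarrow>\<^sub>E {..D})" using assms(1) by (simp add: finite_PiE)
  have "reval x (rsubst g Q) = 0" for x
    using rel by (simp add: reval_rsubst Q_def reval_sum mono_eval_superset[OF assms(1) keys] mon)
  then have "rsubst g Q = 0" by (rule reval_eq_zero_imp)
  moreover have "\<forall>m\<in>Poly_Mapping.keys Q. Poly_Mapping.keys m \<subseteq> I"
  proof
    fix m assume "m \<in> Poly_Mapping.keys Q"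
    then obtain \<nu> where "m \<in> Poly_Mapping.keys (Poly_Mapping.single (mon \<nu>) (c \<nu>))"
      using keys_sum[of "\<lambda>\<nu>. Poly_Mapping.single (mon \<nu>) (c \<nu>)" "I \<rightarrow>\<^sub>E {..D}"] unfolding Q_def by blast
    then show "Poly_Mapping.keys m \<subseteq> I" using keys by (auto split: if_splits)
  qed
  ultimately have "Q = 0" using assms(2) unfolding alg_independent_def by blast
  then have "0 = Poly_Mapping.lookup Q (mon \<mu>)" by simp
  also have "\<dots> = (\<Sum>\<nu>\<in>I \<rightarrow>\<^sub>E {..D}. if \<nu> = \<mu> then c \<nu> else 0)"
    unfolding Q_def lookup_sum lookup_single when_def using inj \<mu>
    by (intro sum.cong) (auto dest: inj_onD)
  finally show ?thesis using fin \<mu> by simp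
qed

section \<open>Zero sets of polynomials are null\<close>

lemma polyfun_borel_measurable:
  assumes "f \<in> polyfun X" "X \<subseteq> I"
  shows "f \<in> borel_measurable (\<Pi>\<^sub>M k\<in>I. lborel)"
  using assms
proof induction
  case (polyfun_var k)
  then have "(\<lambda>x. x k) \<in> measurable (\<Pi>\<^sub>M k\<in>I. lborel) lborel"
    by (intro measurable_component_singleton) auto
  then show ?case by simp
qed auto

lemma polyfun_fix_coord:
  assumes "f \<in> polyfun (insert i X)"
  shows "(\<lambda>x. f (x(i := c))) \<in> polyfun X"
  using assms
proof induction
  case (polyfun_var k)
  then show ?case by (cases "k = i") (auto intro: polyfun_intros)
qed (auto intro: polyfun_intros)

text \<open>Induction with Fubini: for almost all values of the other coordinates, the restriction
  to coordinate \<open>i\<close> is nonzero at \<open>a i\<close>, hence a univariate polynomial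
  with finitely many zeros.\<close>

lemma polyfun_AE_nonzero:
  assumes "finite I" "f \<in> polyfun I" "f a \<noteq> 0"
  shows "AE x in (\<Pi>\<^sub>M k\<in>I. lborel). f x \<noteq> 0"
  using assms
proof (induction I arbitrary: f rule: finite_induct)
  case empty
  then have "f x = f a" for x by (intro polyfun_cong[of f "{}"]) auto
  with empty have "f x \<noteq> 0" for x by metis
  then show ?case by simp
next
  case (insert i I)
  interpret product_sigma_finite "\<lambda>_. lborel :: real measure"
    by (simp add: product_sigma_finite_def sigma_finite_lborel)
  have f[measurable]: "f \<in> borel_measurable (\<Pi>\<^sub>M k\<in>insert i I. lborel)"
    using insert.prems(1) by (rule polyfun_borel_measurable) auto
  define h where "h x = (if f x = 0 then 1 else 0 :: ennreal)" for x
  have h[measurable]: "h \<in> borel_measurable (\<Pi>\<^sub>M k\<in>insert i I. lborel)"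
    unfolding h_def by measurable
  have "AE x in (\<Pi>\<^sub>M k\<in>I. lborel). f (x(i := a i)) \<noteq> 0"
    using insert.prems by (intro insert.IH polyfun_fix_coord) auto
  then have "AE x in (\<Pi>\<^sub>M k\<in>I. lborel). (\<integral>\<^sup>+ y. h (x(i := y)) \<partial>lborel) = 0"
  proof (rule AE_mp[OF _ AE_I2], intro impI)
    fix x assume fx: "f (x(i := a i)) \<noteq> 0"
    obtain q where q: "\<And>t. f (x(i := t)) = poly q t" using polyfun_coord[OF insert.prems(1)] by blast
    then have "q \<noteq> 0" using fx by auto
    then have fin: "finite {t. poly q t = 0}" by (rule poly_roots_finite)
    have "(\<integral>\<^sup>+ y. h (x(i := y)) \<partial>lborel) = (\<integral>\<^sup>+ y. indicator {t. poly q t = 0} y \<partial>lborel)"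
      by (intro nn_integral_cong) (auto simp: h_def q indicator_def)
    also have "\<dots> = emeasure lborel {t. poly q t = 0}"
      using fin by (intro nn_integral_indicator) (auto intro: borel_closed finite_imp_closed)
    also have "\<dots> = 0" using fin by (intro emeasure_lborel_countable countable_finite)
    finally show "(\<integral>\<^sup>+ y. h (x(i := y)) \<partial>lborel) = 0" .
  qed
  then have "(\<integral>\<^sup>+ x. (\<integral>\<^sup>+ y. h (x(i := y)) \<partial>lborel) \<partial>(\<Pi>\<^sub>M k\<in>I. lborel)) = 
      (\<integral>\<^sup>+ x. 0 \<partial>(\<Pi>\<^sub>M k\<in>I. (lborel :: real measure)))"
    by (rule nn_integral_cong_AE)
  then have "integral\<^sup>N (\<Pi>\<^sub>M k\<in>insert i I. lborel) h = 0"
    using product_nn_integral_insert[OF insert.hyps h] by simp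
  then have "AE x in (\<Pi>\<^sub>M k\<in>insert i I. lborel). h x = 0"
    by (simp add: nn_integral_0_iff_AE)
  then show ?case by (rule AE_mp) (auto simp: h_def split: if_splits)
qed

section \<open>Gram matrices\<close>

text \<open>For a simple graph, the coordinates of \<open>graph_proj E\<close> written as ordered
  pairs, that is, within a finite type over which square matrices can be formed.\<close>

definition gram_index :: "'m::{finite,linorder} set set \<Rightarrow> ('m \<times> 'm) set" where
  "gram_index E = {(i, j). i = j \<or> (i < j \<and> {i, j} \<in> E)}"

lemma gram_index_eq:
  assumes "simple_graph E"
  shows "gram_index E = (\<lambda>i. (i, i)) ` UNIV \<union> (\<lambda>e. (Min e, Max e)) ` E"
    and "inj_on (\<lambda>e. (Min e, Max e)) E"
    and "\<And>e. e \<in> E \<Longrightarrow> Min e < Max e"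
proof -
  have *: "\<exists>i j. e = {i, j} \<and> i < j \<and> Min e = i \<and> Max e = j" if "e \<in> E" for e
  proof -
    have "card e = 2" using assms that by (auto simp: simple_graph_def)
    then obtain i j where "e = {i, j}" "i < j" by (metis card_2_iff insert_commute neqE)
    then show ?thesis by (intro exI[of _ i] exI[of _ j]) auto
  qed
  show "gram_index E = (\<lambda>i. (i, i)) ` UNIV \<union> (\<lambda>e. (Min e, Max e)) ` E"
  proof (intro equalityI subsetI)
    fix a assume "a \<in> gram_index E"
    then obtain i j where a: "a = (i, j)" "i = j \<or> i < j \<and> {i, j} \<in> E" by (auto simp: gram_index_def)
    show "a \<in> (\<lambda>i. (i, i)) ` UNIV \<union> (\<lambda>e. (Min e, Max e)) ` E"
    proof (cases "i = j")
      case False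
      then have "i < j" "{i, j} \<in> E" using a by auto
      moreover have "a = (Min {i, j}, Max {i, j})" using a \<open>i < j\<close> by auto
      ultimately show ?thesis by blast
    qed (use a in auto)
  next
    fix a assume "a \<in> (\<lambda>i. (i, i)) ` UNIV \<union> (\<lambda>e. (Min e, Max e)) ` E"
    then show "a \<in> gram_index E" using * by (force simp: gram_index_def)
  qed
  show "inj_on (\<lambda>e. (Min e, Max e)) E" using * by (intro inj_onI) (metis prod.inject)
  show "Min e < Max e" if "e \<in> E" for e using *[OF that] by auto
qed

lemma sum_gram_index:
  assumes "simple_graph E"
  shows "(\<Sum>a\<in>gram_index E. g a) = (\<Sum>i\<in>UNIV. g (i, i)) + (\<Sum>e\<in>E. g (Min e, Max e))"
proof -
  have "(\<Sum>a\<in>gram_index E. g a) =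
      (\<Sum>a\<in>(\<lambda>i. (i, i)) ` UNIV. g a) + (\<Sum>a\<in>(\<lambda>e. (Min e, Max e)) ` E. g a)"
    unfolding gram_index_eq(1)[OF assms] using gram_index_eq(3)[OF assms]
    by (intro sum.union_disjoint) fastforce+
  then show ?thesis
    using gram_index_eq(2)[OF assms] by (simp add: sum.reindex inj_on_def)
qed

text \<open>Partial derivative of the \<open>(i, j)\<close> entry of \<open>P^T P\<close> with
  respect to \<open>P (k, l)\<close>; for \<open>i = j\<close> the two terms add up to a factor
  2.\<close>

definition gram_grad :: "(nat \<times> 'm \<Rightarrow> real) \<Rightarrow> 'm \<times> 'm \<Rightarrow> nat \<times> 'm \<Rightarrow> real" where
  "gram_grad P = (\<lambda>(i, j) (k, l). (if l = i then P (k, j) else 0) + (if l = j then P (k, i) else 0))"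

text \<open>The derivative of the entries \<open>gram_index E\<close> of the Gram matrix at \<open>P\<close> in the directions \<open>V\<close>,
  completed to a square matrix by the identity on the remaining entries.\<close>

definition gram_jac :: "'m::{finite,linorder} set set \<Rightarrow> nat \<Rightarrow> ('m \<times> 'm \<Rightarrow> nat \<times> 'm \<Rightarrow> real) \<Rightarrow>
    (nat \<times> 'm \<Rightarrow> real) \<Rightarrow> real ^ ('m \<times> 'm) ^ ('m \<times> 'm)" where
  "gram_jac E n V P = (\<chi> a b. if a \<in> gram_index E
     then (if b \<in> gram_index E
       then \<Sum>k<n. P (k, snd a) * V b (k, fst a) + P (k, fst a) * V b (k, snd a) else 0)
     else (if a = b then 1 else 0))"

lemma gram_jac_mult:
  "(gram_jac E n V P *v Y) $ a = (if a \<in> gram_index E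
     then (\<Sum>k<n. P (k, snd a) * (\<Sum>b\<in>gram_index E. Y $ b * V b (k, fst a)) +
                  P (k, fst a) * (\<Sum>b\<in>gram_index E. Y $ b * V b (k, snd a)))
     else Y $ a)"
proof (cases "a \<in> gram_index E")
  case True
  have "(gram_jac E n V P *v Y) $ a = (\<Sum>b\<in>UNIV. if b \<in> gram_index E then
      (\<Sum>k<n. P (k, snd a) * V b (k, fst a) + P (k, fst a) * V b (k, snd a)) * Y $ b else 0)"
    unfolding matrix_vector_mult_def gram_jac_def using True by (auto intro!: sum.cong)
  also have "\<dots> = (\<Sum>b\<in>gram_index E.
      (\<Sum>k<n. P (k, snd a) * V b (k, fst a) + P (k, fst a) * V b (k, snd a)) * Y $ b)"
    by (subst sum.inter_filter[symmetric]) auto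
  also have "\<dots> = (\<Sum>k<n. \<Sum>b\<in>gram_index E.
      (P (k, snd a) * V b (k, fst a) + P (k, fst a) * V b (k, snd a)) * Y $ b)"
    by (subst sum.swap) (simp add: sum_distrib_right)
  finally show ?thesis
    using True by (simp add: sum_distrib_left sum.distrib[symmetric] algebra_simps)
next
  case False
  then have "(gram_jac E n V P *v Y) $ a = (\<Sum>b\<in>UNIV. if b = a then Y $ b else 0)"
    unfolding matrix_vector_mult_def gram_jac_def vec_lambda_beta by (intro sum.cong) auto
  then show ?thesis using False by simp
qed

text \<open>With \<open>V\<close> held fixed, every matrix entry is affine in \<open>P\<close>, so a
  single nonzero value of the determinant spreads to almost all \<open>P\<close>.\<close>

lemma det_gram_jac_polyfun:
  "(\<lambda>P. det (gram_jac E n V P)) \<in> polyfun ({..<n} \<times> UNIV)"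
proof -
  have "(\<lambda>P. gram_jac E n V P $ a $ b) \<in> polyfun ({..<n} \<times> UNIV)" for a b
    by (cases "a \<in> gram_index E"; cases "b \<in> gram_index E")
      (auto simp: gram_jac_def intro!: polyfun_intros)
  then show ?thesis unfolding det_def by (intro polyfun_sum polyfun_mult polyfun_prod polyfun_const)
qed

text \<open>The quadratic form of a Gram matrix is a sum of squares, and the added term contributes
  \<open>\<epsilon>\<close> times the squared norm.\<close>

lemma pos_def_gram_plus:
  assumes "\<epsilon> > 0"
  shows "pos_def (gram n P + mat \<epsilon>)"
  unfolding pos_def_def
proof (intro conjI allI impI)
  show "transpose (gram n P + mat \<epsilon>) = gram n P + mat \<epsilon>"
    by (auto simp: transpose_def gram_def mat_def vec_eq_iff mult.commute)
  fix x :: "real ^ 'a" assume "x \<noteq> 0"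
  have "x \<bullet> (gram n P *v x) = (\<Sum>i\<in>UNIV. \<Sum>j\<in>UNIV. \<Sum>k<n. (P (k, i) * x $ i) * (P (k, j) * x $ j))"
    by (simp add: inner_vec_def matrix_vector_mult_def gram_def sum_distrib_left sum_distrib_right mult_ac)
  also have "\<dots> = (\<Sum>i\<in>UNIV. \<Sum>k<n. \<Sum>j\<in>UNIV. (P (k, i) * x $ i) * (P (k, j) * x $ j))"
    by (intro sum.cong refl sum.swap)
  also have "\<dots> = (\<Sum>k<n. \<Sum>i\<in>UNIV. \<Sum>j\<in>UNIV. (P (k, i) * x $ i) * (P (k, j) * x $ j))"
    by (rule sum.swap)
  also have "\<dots> = (\<Sum>k<n. (\<Sum>i\<in>UNIV. P (k, i) * x $ i)\<^sup>2)"
    by (simp add: power2_eq_square sum_product)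
  also have "\<dots> \<ge> 0" by (intro sum_nonneg) auto
  finally have "x \<bullet> (gram n P *v x) \<ge> 0" .
  moreover have "mat \<epsilon> *v x = \<epsilon> *\<^sub>R x"
    by (simp add: vec_eq_iff matrix_vector_mult_def mat_def if_distrib if_distribR cong: if_cong)
  ultimately show "x \<bullet> ((gram n P + mat \<epsilon>) *v x) > 0"
    using \<open>x \<noteq> 0\<close> assms by (simp add: matrix_vector_mult_add_rdistrib inner_add_right add_nonneg_pos)
qed

section \<open>Openness of the Gram map and positive definite completion\<close>

lemma has_derivative_vec_componentwise:
  fixes f :: "'a::real_normed_vector \<Rightarrow> real ^ 'n"
  assumes "\<And>i. ((\<lambda>x. f x $ i) has_derivative (\<lambda>x. f' x $ i)) F"
  shows "(f has_derivative f') F"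
proof -
  have "((\<lambda>x. \<Sum>i\<in>UNIV. f x $ i *\<^sub>R axis i (1::real)) has_derivative
      (\<lambda>x. \<Sum>i\<in>UNIV. f' x $ i *\<^sub>R axis i 1)) F"
    using assms by (intro has_derivative_sum has_derivative_scaleR_left)
  moreover have basis: "(\<Sum>i\<in>UNIV. v $ i *\<^sub>R axis i 1) = v" for v :: "real ^ 'n"
    by (simp add: vec_eq_iff axis_def if_distrib cong: if_cong)
  ultimately show ?thesis by (simp only: basis)
qed

text \<open>If the derivative of the selected Gram entries is onto at \<open>P\<close>, then some \<open>Q\<close> near \<open>P\<close> has the
  same selected entries off the diagonal and diagonal entries smaller by \<open>\<epsilon>\<close>.\<close>

lemma gram_completion:
  fixes E :: "'m::{finite,linorder} set set"
  assumes "simple_graph E" "det (gram_jac E n V P) \<noteq> 0"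
  shows "\<exists>\<Sigma>. pos_def \<Sigma> \<and> graph_proj E (gram n P) = graph_proj E \<Sigma>"
proof -
  define I where "I = gram_index E"
  \<comment> \<open>\<open>Q Y\<close> displaces \<open>P\<close> along the directions
    \<open>V\<close>. \<open>T\<close> records the selected Gram entries and copies the other
    coordinates, which makes it a self-map of one space.\<close>
  define Q where "Q Y = (\<lambda>kl. P kl + (\<Sum>b\<in>I. Y $ b * V b kl))" for Y :: "real ^ ('m \<times> 'm)"
  define T where "T Y = (\<chi> a. if a \<in> I then gram n (Q Y) $ fst a $ snd a else Y $ a)"
    for Y :: "real ^ ('m \<times> 'm)"
  define A where "A = gram_jac E n V P"
  have Q0: "Q 0 = P" by (simp add: Q_def)
  have Q': "((\<lambda>Y. Q Y kl) has_derivative (\<lambda>Y. \<Sum>b\<in>I. Y $ b * V b kl)) (at Z)" for kl Z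
    unfolding Q_def by (auto intro!: derivative_eq_intros bounded_linear.has_derivative[OF bounded_linear_vec_nth])
  have gramD: "((\<lambda>Y. gram n (Q Y) $ i $ j) has_derivative
      (\<lambda>Y. \<Sum>k<n. P (k, j) * (\<Sum>b\<in>I. Y $ b * V b (k, i)) + P (k, i) * (\<Sum>b\<in>I. Y $ b * V b (k, j)))) (at 0)" for i j
    unfolding gram_def by (auto intro!: derivative_eq_intros Q' simp: Q0 algebra_simps)
  have T': "(T has_derivative (*v) A) (at 0)"
  proof (rule has_derivative_vec_componentwise)
    fix a
    show "((\<lambda>Y. T Y $ a) has_derivative (\<lambda>Y. (A *v Y) $ a)) (at 0)"
      unfolding T_def A_def gram_jac_mult using gramD[of "fst a" "snd a"]
      by (cases "a \<in> I")
        (simp_all add: I_def bounded_linear.has_derivative[OF bounded_linear_vec_nth])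
  qed
  have contT: "continuous_on UNIV T"
    unfolding T_def
  proof (intro continuous_on_vec_lambda)
    fix a
    have "continuous_on UNIV (\<lambda>Y. Q Y kl)" for kl
      using Q' by (intro continuous_at_imp_continuous_on ballI has_derivative_continuous)
    then show "continuous_on UNIV (\<lambda>Y. if a \<in> I then gram n (Q Y) $ fst a $ snd a else Y $ a)"
      by (cases "a \<in> I") (auto simp: gram_def intro!: continuous_intros)
  qed
  obtain B where B: "A ** B = mat 1"
    using assms(2) unfolding A_def[symmetric] invertible_det_nz[symmetric] invertible_def by auto
  \<comment> \<open>The derivative \<open>A\<close> has the right inverse \<open>B\<close>, so the
    image of \<open>T\<close> is a neighbourhood of \<open>T 0\<close>.\<close>
  have "T 0 \<in> interior (T ` UNIV)"
  proof (rule sussmann_open_mapping[OF open_UNIV contT _ T'])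
    show "bounded_linear ((*v) B)" by simp
    show "(*v) A \<circ> (*v) B = id" using B by (auto simp: matrix_vector_mul_assoc)
  qed auto
  then obtain r where r: "r > 0" "ball (T 0) r \<subseteq> range T" by (auto simp: mem_interior)
  define D :: "real ^ ('m \<times> 'm)" where "D = (\<chi> a. if fst a = snd a then 1 else 0)"
  \<comment> \<open>Small enough for \<open>\<epsilon> *\<^sub>R D\<close> to have norm below
    \<open>r\<close>; the added 1 keeps the denominator positive.\<close>
  define \<epsilon> where "\<epsilon> = r / (2 * (norm D + 1))"
  have \<epsilon>: "\<epsilon> > 0" using r by (simp add: \<epsilon>_def add_nonneg_pos)
  have "norm (\<epsilon> *\<^sub>R D) < r"
  proof -
    have "norm D < 2 * (norm D + 1)" by (smt (verit) norm_ge_zero)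
    then have "\<epsilon> * norm D < \<epsilon> * (2 * (norm D + 1))" using \<epsilon> by (rule mult_strict_left_mono)
    also have "\<dots> = r"
    proof -
      have "norm D + 1 \<noteq> 0" by (smt (verit) norm_ge_zero)
      then show ?thesis by (simp add: \<epsilon>_def)
    qed
    finally show ?thesis using \<epsilon> by simp
  qed
  then have "T 0 - \<epsilon> *\<^sub>R D \<in> ball (T 0) r" by (simp add: dist_norm)
  \<comment> \<open>The diagonal is lowered by \<open>\<epsilon>\<close> within the image of
    \<open>T\<close>; adding \<open>mat \<epsilon>\<close> restores it.\<close>
  with r obtain Y where Y: "T Y = T 0 - \<epsilon> *\<^sub>R D" by (metis imageE subsetD)
  have entry: "gram n (Q Y) $ i $ j + (if i = j then \<epsilon> else 0) = gram n P $ i $ j" if "(i, j) \<in> I" for i j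
    using arg_cong[OF Y, of "\<lambda>v. v $ (i, j)"] that by (auto simp: T_def D_def Q0)
  have "graph_proj E (gram n P) = graph_proj E (gram n (Q Y) + mat \<epsilon>)"
    unfolding graph_proj_def
  proof (rule restrict_ext)
    fix v :: "'m + 'm set" assume v: "v \<in> UNIV <+> E"
    show "case_sum (\<lambda>i. gram n P $ i $ i) (\<lambda>e. gram n P $ Min e $ Max e) v =
      case_sum (\<lambda>i. (gram n (Q Y) + mat \<epsilon>) $ i $ i) (\<lambda>e. (gram n (Q Y) + mat \<epsilon>) $ Min e $ Max e) v"
    proof (cases v)
      case (Inl i)
      then show ?thesis using entry[of i i] by (simp add: I_def gram_index_def mat_def)
    next
      case (Inr e)
      then have e: "e \<in> E" using v by auto
      then have "(Min e, Max e) \<in> I" "Min e \<noteq> Max e"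
        using gram_index_eq(1)[OF assms(1)] gram_index_eq(3)[OF assms(1) e] e by (auto simp: I_def)
      then show ?thesis using entry[of "Min e" "Max e"] Inr by (simp add: mat_def)
    qed
  qed
  then show ?thesis using pos_def_gram_plus[OF \<epsilon>] by blast
qed

section \<open>Squared distances and coning\<close>

definition sqdist :: "nat \<Rightarrow> 'm \<Rightarrow> 'm \<Rightarrow> (nat \<times> 'm \<Rightarrow> real) \<Rightarrow> real" where
  "sqdist d i j x = (\<Sum>k<d. (x (k, i) - x (k, j))\<^sup>2)"

lemma reval_sqdist_poly: "reval x (sqdist_poly d i j) = sqdist d i j x"
  by (simp add: sqdist_poly_def sqdist_def rvar_def reval_sum reval_power reval_diff)

lemma sqdist_polyfun: "sqdist d i j \<in> polyfun ({..<d} \<times> UNIV)"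
  unfolding sqdist_def by (intro polyfun_intros) auto

lemma pd_sqdist:
  assumes "k < d"
  shows "pd (k, l) (sqdist d i j) x =
    2 * (x (k, i) - x (k, j)) * ((if l = i then 1 else 0) - (if l = j then 1 else 0))"
proof -
  have "((\<lambda>t. sqdist d i j (x((k, l) := t))) has_field_derivative
     (\<Sum>h<d. if h = k then 2 * (x (k, i) - x (k, j)) * ((if l = i then 1 else 0) - (if l = j then 1 else 0)) else 0))
     (at (x (k, l)))"
    unfolding sqdist_def
  proof (intro DERIV_sum)
    fix h
    have v: "((\<lambda>t. (x((k, l) := t)) (h, u)) has_field_derivative (if h = k \<and> l = u then 1 else 0)) (at (x (k, l)))" for u
      by auto
    show "((\<lambda>t. ((x((k, l) := t)) (h, i) - (x((k, l) := t)) (h, j))\<^sup>2) has_field_derivative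
      (if h = k then 2 * (x (k, i) - x (k, j)) * ((if l = i then 1 else 0) - (if l = j then 1 else 0)) else 0))
       (at (x (k, l)))"
      by (rule DERIV_cong[OF DERIV_power[OF DERIV_diff[OF v v]]]) auto
  qed
  from DERIV_imp_deriv[OF this] show ?thesis using assms by (simp add: pd_def)
qed

text \<open>Coning: a placement \<open>p\<close> in dimension \<open>d\<close> without equilibrium stress, lifted to height \<open>1\<close> in
  dimension \<open>Suc d\<close>, has no stress with respect to the Gram entries, because the last coordinate forces
  the diagonal part of the stress to be minus its row sums.\<close>

lemma coning:
  assumes "simple_graph E"
    and p: "\<And>\<omega>. (\<forall>k\<in>{..<d} \<times> UNIV. (\<Sum>e\<in>E. \<omega> e * pd k (sqdist d (Min e) (Max e)) p) = 0)
      \<Longrightarrow> (\<forall>e\<in>E. \<omega> e = 0)"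
    and P: "P = (\<lambda>(k, l). if k < d then p (k, l) else 1)"
    and U: "\<And>k l. k \<le> d \<Longrightarrow> (\<Sum>b\<in>gram_index E. y b * gram_grad P b (k, l)) = 0"
    and a: "a \<in> gram_index E"
  shows "y a = 0"
proof -
  have U': "2 * y (l, l) * P (k, l) + (\<Sum>e\<in>E. y (Min e, Max e) *
      ((if l = Min e then P (k, Max e) else 0) + (if l = Max e then P (k, Min e) else 0))) = 0"
    if "k \<le> d" for k l
  proof -
    have "(\<Sum>i\<in>UNIV. y (i, i) * gram_grad P (i, i) (k, l)) = (\<Sum>i\<in>UNIV. if i = l then 2 * y (l, l) * P (k, l) else 0)"
      by (intro sum.cong) (auto simp: gram_grad_def)
    then show ?thesis using U[OF that, of l] unfolding sum_gram_index[OF assms(1)]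
      by (simp add: gram_grad_def)
  qed
  \<comment> \<open>This is the row \<open>k = d\<close>, where every entry of \<open>P\<close> is
    1.\<close>
  have row: "2 * y (l, l) = - (\<Sum>e\<in>E. y (Min e, Max e) *
      ((if l = Min e then 1 else 0) + (if l = Max e then 1 else 0)))" for l
    using U'[of d l] by (simp add: P eq_neg_iff_add_eq_0 cong: if_cong)
  have "\<forall>e\<in>E. y (Min e, Max e) = 0"
  proof (rule p, intro ballI)
    fix kl assume "kl \<in> {..<d} \<times> (UNIV :: 'a set)"
    then obtain k l where kl: "kl = (k, l)" "k < d" by auto
    \<comment> \<open>An edge at \<open>l\<close> contributes twice its stress times the difference
      of \<open>p (k, l)\<close> and the value at the other endpoint. The first parts are summed by
      \<open>row\<close>, the second by \<open>U'\<close>, and they cancel.\<close>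
    have "(\<Sum>e\<in>E. y (Min e, Max e) * pd (k, l) (sqdist d (Min e) (Max e)) p) =
      (\<Sum>e\<in>E. 2 * (p (k, l) * (y (Min e, Max e) * ((if l = Min e then 1 else 0) + (if l = Max e then 1 else 0))) -
         y (Min e, Max e) * ((if l = Min e then P (k, Max e) else 0) + (if l = Max e then P (k, Min e) else 0))))"
      using gram_index_eq(3)[OF assms(1)] kl(2)
      by (intro sum.cong refl) (auto simp: pd_sqdist P algebra_simps)
    also have "\<dots> = 2 * (p (k, l) * - (2 * y (l, l)) + 2 * y (l, l) * P (k, l))"
      using U'[of k l] row[of l] kl(2)
      by (simp add: sum_subtractf flip: sum_distrib_left)
    also have "\<dots> = 0" using kl(2) by (simp add: P)
    finally show "(\<Sum>e\<in>E. y (Min e, Max e) * pd kl (sqdist d (Min e) (Max e)) p) = 0"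
      by (simp add: kl)
  qed
  moreover from this have "y (l, l) = 0" for l using row[of l] by simp
  ultimately show ?thesis using a unfolding gram_index_eq(1)[OF assms(1)] by auto
qed

text \<open>Moving along the gradients turns the derivative into \<open>J J^T\<close>, where the
  rows of \<open>J\<close> are the gradients of the selected entries. The hypothesis is injectivity
  of \<open>J^T\<close>, and \<open>J J^T Y = 0\<close> forces \<open>|J^T Y|^2 = 0\<close>.\<close>

lemma det_gram_jac_nonzero:
  fixes E :: "'m::{finite,linorder} set set"
  assumes "\<And>y a. \<lbrakk>\<And>k l. k < n \<Longrightarrow> (\<Sum>b\<in>gram_index E. y b * gram_grad P b (k, l)) = 0; a \<in> gram_index E\<rbrakk>
      \<Longrightarrow> y a = 0"
  shows "det (gram_jac E n (gram_grad P) P) \<noteq> 0"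
proof -
  define A where "A = gram_jac E n (gram_grad P) P"
  have "Y = 0" if AY: "A *v Y = 0" for Y
  proof -
    \<comment> \<open>This is \<open>J^T Y\<close>, arranged as a matrix.\<close>
    define U where "U k l = (\<Sum>b\<in>gram_index E. Y $ b * gram_grad P b (k, l))" for k l
    have AY': "(A *v Y) $ a = (if a \<in> gram_index E
        then (\<Sum>k<n. P (k, snd a) * U k (fst a) + P (k, fst a) * U k (snd a)) else Y $ a)" for a
      by (simp add: A_def U_def gram_jac_mult)
    have delta: "(\<Sum>l\<in>UNIV. (if l = u then c else 0) * f l) = c * f u" for u :: 'm and c and f :: "'m \<Rightarrow> real"
    proof -
      have "(\<Sum>l\<in>UNIV. (if l = u then c else 0) * f l) = (\<Sum>l\<in>UNIV. if l = u then c * f l else 0)"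
        by (intro sum.cong) auto
      then show ?thesis by simp
    qed
    have grad: "(\<Sum>l\<in>UNIV. gram_grad P a (k, l) * U k l) = P (k, snd a) * U k (fst a) + P (k, fst a) * U k (snd a)" for a k
      by (cases a) (simp add: gram_grad_def distrib_right sum.distrib delta)
    have "(\<Sum>k<n. \<Sum>l\<in>UNIV. (U k l)\<^sup>2) =
        (\<Sum>k<n. \<Sum>l\<in>UNIV. \<Sum>a\<in>gram_index E. Y $ a * (gram_grad P a (k, l) * U k l))"
      by (simp add: power2_eq_square U_def[of _ _] sum_distrib_right mult.assoc)
    also have "\<dots> = (\<Sum>k<n. \<Sum>a\<in>gram_index E. \<Sum>l\<in>UNIV. Y $ a * (gram_grad P a (k, l) * U k l))"
      by (intro sum.cong refl sum.swap)
    also have "\<dots> = (\<Sum>a\<in>gram_index E. \<Sum>k<n. \<Sum>l\<in>UNIV. Y $ a * (gram_grad P a (k, l) * U k l))"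
      by (rule sum.swap)
    also have "\<dots> = (\<Sum>a\<in>gram_index E. Y $ a * (\<Sum>k<n. P (k, snd a) * U k (fst a) + P (k, fst a) * U k (snd a)))"
      by (simp add: grad flip: sum_distrib_left)
    also have "\<dots> = (\<Sum>a\<in>gram_index E. Y $ a * (A *v Y) $ a)"
      by (simp add: AY')
    also have "\<dots> = 0" using AY by simp
    finally have U0: "(\<Sum>k<n. \<Sum>l\<in>UNIV. (U k l)\<^sup>2) = 0" .
    have "U k l = 0" if "k < n" for k l
    proof -
      have "(\<Sum>l\<in>UNIV. (U k l)\<^sup>2) = 0"
        using U0 that by (subst (asm) sum_nonneg_eq_0_iff) (auto intro: sum_nonneg)
      then show ?thesis by (subst (asm) sum_nonneg_eq_0_iff) auto
    qed
    then have "Y $ a = 0" if "a \<in> gram_index E" for a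
      using assms[of "($) Y" a] that by (simp add: U_def)
    moreover have "Y $ a = 0" if "a \<notin> gram_index E" for a
      using AY'[of a] AY that by simp
    ultimately show ?thesis by (auto simp: vec_eq_iff)
  qed
  then have "invertible A"
    unfolding invertible_left_inverse matrix_left_invertible_ker by blast
  then show ?thesis by (simp add: invertible_det_nz A_def)
qed

section \<open>The bound on the maximum likelihood threshold\<close>

theorem theorem1p2:
  fixes E :: "'m::{finite,linorder} set set" and n :: nat
  assumes "simple_graph E"
    and "n \<ge> 1"
    and "rigidity_independent (n - 1) E"
  shows "mlt E \<le> n"
proof -
  define d where "d = n - 1"
  define X where "X = {..<d} \<times> (UNIV :: 'm set)"
  have "\<exists>p. \<forall>\<omega>. (\<forall>k\<in>X. (\<Sum>e\<in>E. \<omega> e * pd k (sqdist d (Min e) (Max e)) p) = 0) \<longrightarrow> (\<forall>e\<in>E. \<omega> e = 0)"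
  proof (rule jacobian_criterion)
    fix D and c :: "('m set \<Rightarrow> nat) \<Rightarrow> real" and \<mu>
    assume "\<forall>x. (\<Sum>\<mu>\<in>E \<rightarrow>\<^sub>E {..D}. c \<mu> * (\<Prod>e\<in>E. sqdist d (Min e) (Max e) x ^ \<mu> e)) = 0"
      and "\<mu> \<in> E \<rightarrow>\<^sub>E {..D}"
    then show "c \<mu> = 0"
      using assms(3) unfolding rigidity_independent_def d_def[symmetric]
      by (intro alg_independent_no_relation[of E "\<lambda>e. sqdist_poly d (Min e) (Max e)"])
        (auto simp: reval_sqdist_poly)
  qed (auto simp: X_def sqdist_polyfun)
  then obtain p where p: "\<And>\<omega>. (\<forall>k\<in>X. (\<Sum>e\<in>E. \<omega> e * pd k (sqdist d (Min e) (Max e)) p) = 0)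
      \<Longrightarrow> (\<forall>e\<in>E. \<omega> e = 0)" by blast
  \<comment> \<open>The cone over \<open>p\<close>: rows below \<open>d\<close> come from
    \<open>p\<close>, and row \<open>d\<close> consists of ones.\<close>
  define P where "P = (\<lambda>(k, l). if k < d then p (k, l) else 1)"
  have "det (gram_jac E n (gram_grad P) P) \<noteq> 0"
  proof (rule det_gram_jac_nonzero)
    fix y :: "'m \<times> 'm \<Rightarrow> real" and a
    assume U: "\<And>k l. k < n \<Longrightarrow> (\<Sum>b\<in>gram_index E. y b * gram_grad P b (k, l)) = 0"
      and a: "a \<in> gram_index E"
    have "(\<Sum>b\<in>gram_index E. y b * gram_grad P b (k, l)) = 0" if "k \<le> d" for k l
      using that assms(2) by (intro U) (auto simp: d_def)
    then show "y a = 0"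
      using a coning[of E d p P y a, OF assms(1) p[unfolded X_def] P_def] by simp
  qed
  \<comment> \<open>The directions stay the gradients at \<open>P\<close> while \<open>Q\<close>
    varies, so nonvanishing at \<open>Q = P\<close> extends to almost all \<open>Q\<close>.\<close>
  then have "AE Q in (\<Pi>\<^sub>M kj\<in>{..<n} \<times> (UNIV :: 'm set). lborel). det (gram_jac E n (gram_grad P) Q) \<noteq> 0"
    by (intro polyfun_AE_nonzero[OF _ det_gram_jac_polyfun]) auto
  then have "mle_exists_as E n"
    unfolding mle_exists_as_def by (rule AE_mp) (auto intro: gram_completion[OF assms(1)])
  then show ?thesis unfolding mlt_def by (rule Least_le)
qed

end
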